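(* Let $b\ge 1/5$ be a constant and let $\theta=\mathrm{tail}(2.01\max\{66,b\})$. Then $\mathrm{cb}^{1,\mu}_\theta(\mathrm{ORT}_{b,n})=\Omega(n)$, and $\mathrm{IC}^\mu_{\theta/400}(\mathrm{ORT}_{b,n})=\Omega(n)$, where $\mu=\mu_n$ is the uniform distribution on $\{-1,1\}^n\times\{-1,1\}^n$.
   Context: $\mathrm{ORT}_{b,n}:\{-1,1\}^n\times\{-1,1\}^n\to\{-1,1\}$ is $\mathrm{ORT}_{b,n}(x,y)=1$ if $|\langle x,y\rangle|\le b\sqrt n$ and $-1$ otherwise. $\mathrm{tail}(x)=\frac{1}{\sqrt{2\pi}}\int_x^\infty e^{-s^2/2}ds$. For a distribution $\lambda$ on $\mathcal{X}\times\mathcal{Y}$ and $g:\mathcal{X}\times\mathcal{Y}\to\mathcal{Z}\cup\{*\}$ ($*$ = undefined), a set $S$ is $\varepsilon$-error $z$-monochromatic for $g$ under $\lambda$ if $\lambda(S\setminus(g^{-1}(z)\cup g^{-1}( * )))\le\varepsilon\lambda(S)$, and $\mathrm{cb}^{z,\lambda}_\varepsilon(g)=-\log_2\max\{\lambda(S): S=S_1\times S_2 \text{ a rectangle that is } \varepsilon\text{-error } z\text{-monochromatic}\}$. Information complexity: for a (public- and private-coin) two-party protocol $P$ with public randomness $R$ and transcript $P(X,Y)$, $(X,Y)\sim\lambda$, $\mathrm{icost}^\lambda(P)=I(XY:P(X,Y)\mid R)$; $P$ computes $g$ with error $\varepsilon$ if $\Pr[g(X,Y)\ne *\wedge \mathrm{out}(P(X,Y))\ne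 g(X,Y)]\le\varepsilon$; $\mathrm{IC}^\lambda_\varepsilon(g)$ is the minimum of $\mathrm{icost}^\lambda(P)$ over protocols computing $g$ with error $\varepsilon$. The $\Omega$ is as $n\to\infty$, with constants possibly depending on $b$. *)

theory Defs
  imports "HOL-Probability.Probability" "HOL-Library.Landau_Symbols"
begin

definition cube :: "nat \<Rightarrow> int list set" where
  "cube n = {x. set x \<subseteq> {-1, 1} \<and> length x = n}"

definition unif :: "nat \<Rightarrow> (int list \<times> int list) pmf" where
  "unif n = pmf_of_set (cube n \<times> cube n)"

definition ORT :: "real \<Rightarrow> nat \<Rightarrow> int list \<Rightarrow> int list \<Rightarrow> int" where
  "ORT b n x y = (if real_of_int \<bar>\<Sum>i<n. x ! i * y ! i\<bar> \<le> b * sqrt (real n) then 1 else -1)"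

definition tail :: "real \<Rightarrow> real" where
  "tail x = 1 / sqrt (2 * pi) * (LBINT s:{x..}. exp (- s\<^sup>2 / 2))"

text \<open>In what follows, a partial function \<open>g\<close> has values in \<open>'z option\<close>, where \<open>None\<close> stands
  for ``undefined''.\<close>

definition eps_monochromatic ::
    "real \<Rightarrow> 'z \<Rightarrow> ('x \<times> 'y) pmf \<Rightarrow> ('x \<times> 'y \<Rightarrow> 'z option) \<Rightarrow> ('x \<times> 'y) set \<Rightarrow> bool" where
  "eps_monochromatic \<epsilon> z \<mu> g S \<longleftrightarrow>
     measure_pmf.prob \<mu> (S - (g -` {Some z} \<union> g -` {None})) \<le> \<epsilon> * measure_pmf.prob \<mu> S"

text \<open>When \<open>\<mu>\<close> has finite support the supremum is taken over finitely many values, so it is a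
  maximum. If only null rectangles qualify, the value is \<open>- log 2 0 = 0\<close> instead of \<open>\<infinity>\<close>.\<close>

definition corruption_bound ::
    "'z \<Rightarrow> ('x \<times> 'y) pmf \<Rightarrow> real \<Rightarrow> ('x \<times> 'y \<Rightarrow> 'z option) \<Rightarrow> real" where
  "corruption_bound z \<mu> \<epsilon> g =
     - log 2 (Sup {measure_pmf.prob \<mu> (S\<^sub>1 \<times> S\<^sub>2) | S\<^sub>1 S\<^sub>2. eps_monochromatic \<epsilon> z \<mu> g (S\<^sub>1 \<times> S\<^sub>2)})"

type_synonym coins = "bool list"

text \<open>The bit sent at an inner node is a function of the speaker's input, the speaker's private
  coins and the public coins, in this order; the dependence on the bits sent before is given by the
  position of the node in the tree. After \<open>False\<close> the protocol goes on in the first subtree, after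
  \<open>True\<close> in the second. A leaf carries the output.\<close>

datatype ('x, 'y, 'z) ptree =
    Leaf 'z
  | Alice "'x \<Rightarrow> coins \<Rightarrow> coins \<Rightarrow> bool" "('x, 'y, 'z) ptree" "('x, 'y, 'z) ptree"
  | Bob "'y \<Rightarrow> coins \<Rightarrow> coins \<Rightarrow> bool" "('x, 'y, 'z) ptree" "('x, 'y, 'z) ptree"

primrec run :: "('x, 'y, 'z) ptree \<Rightarrow> 'x \<Rightarrow> 'y \<Rightarrow> coins \<Rightarrow> coins \<Rightarrow> coins \<Rightarrow> bool list" where
  "run (Leaf z) x y r r\<^sub>A r\<^sub>B = []"
| "run (Alice f t\<^sub>0 t\<^sub>1) x y r r\<^sub>A r\<^sub>B =
     (if f x r\<^sub>A r then True # run t\<^sub>1 x y r r\<^sub>A r\<^sub>B else False # run t\<^sub>0 x y r r\<^sub>A r\<^sub>B)"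
| "run (Bob f t\<^sub>0 t\<^sub>1) x y r r\<^sub>A r\<^sub>B =
     (if f y r\<^sub>B r then True # run t\<^sub>1 x y r r\<^sub>A r\<^sub>B else False # run t\<^sub>0 x y r r\<^sub>A r\<^sub>B)"

primrec out :: "('x, 'y, 'z) ptree \<Rightarrow> bool list \<Rightarrow> 'z" where
  "out (Leaf z) m = z"
| "out (Alice f t\<^sub>0 t\<^sub>1) m = (if hd m then out t\<^sub>1 (tl m) else out t\<^sub>0 (tl m))"
| "out (Bob f t\<^sub>0 t\<^sub>1) m = (if hd m then out t\<^sub>1 (tl m) else out t\<^sub>0 (tl m))"

text \<open>The public coins and the two private coin strings are independent, each with an arbitrary
  discrete distribution.\<close>

datatype ('x, 'y, 'z) protocol =
  Protocol (public_coins: "coins pmf") (alice_coins: "coins pmf") (bob_coins: "coins pmf")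
    (tree: "('x, 'y, 'z) ptree")

definition execution ::
    "('x \<times> 'y) pmf \<Rightarrow> ('x, 'y, 'z) protocol \<Rightarrow> (('x \<times> 'y) \<times> coins \<times> coins \<times> coins) pmf" where
  "execution \<mu> P =
     pair_pmf \<mu> (pair_pmf (public_coins P) (pair_pmf (alice_coins P) (bob_coins P)))"

definition transcript ::
    "('x, 'y, 'z) protocol \<Rightarrow> ('x \<times> 'y) \<times> coins \<times> coins \<times> coins \<Rightarrow> bool list" where
  "transcript P = (\<lambda>((x, y), r, r\<^sub>A, r\<^sub>B). run (tree P) x y r r\<^sub>A r\<^sub>B)"

definition icost :: "('x \<times> 'y) pmf \<Rightarrow> ('x, 'y, 'z) protocol \<Rightarrow> real" where
  "icost \<mu> P =
     prob_space.conditional_mutual_information (measure_pmf (execution \<mu> P)) 2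
       (count_space UNIV) (count_space UNIV) (count_space UNIV)
       (\<lambda>((x, y), r, r\<^sub>A, r\<^sub>B). (x, y)) (transcript P) (\<lambda>((x, y), r, r\<^sub>A, r\<^sub>B). r)"

definition computes ::
    "('x \<times> 'y) pmf \<Rightarrow> ('x, 'y, 'z) protocol \<Rightarrow> ('x \<times> 'y \<Rightarrow> 'z option) \<Rightarrow> real \<Rightarrow> bool" where
  "computes \<mu> P g \<epsilon> \<longleftrightarrow>
     measure_pmf.prob (execution \<mu> P)
       {\<omega>. g (fst \<omega>) \<noteq> None \<and> Some (out (tree P) (transcript P \<omega>)) \<noteq> g (fst \<omega>)} \<le> \<epsilon>"

definition IC :: "('x \<times> 'y) pmf \<Rightarrow> real \<Rightarrow> ('x \<times> 'y \<Rightarrow> 'z option) \<Rightarrow> real" where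
  "IC \<mu> \<epsilon> g = (INF P \<in> {P. computes \<mu> P g \<epsilon>}. icost \<mu> P)"

end

theory Submission
  imports Defs "HOL-Probability.Hoeffding" "HOL-Probability.Product_PMF"
begin

text \<open>Let \<open>\<alpha>\<close> and \<open>\<beta>\<close> be distributions on the cube whose relative entropies with respect to the
  uniform distribution are at most \<open>\<delta> n\<close>. The core is that \<open>\<bar>\<langle>x, y\<rangle>\<bar> > B \<surd>n\<close> has probability more
  than \<open>\<theta>\<close> under \<open>\<alpha> \<times> \<beta>\<close>. Couple two copies \<open>x\<close>, \<open>x'\<close> of \<open>\<alpha>\<close> through a common noisy
  observation: then \<open>\<langle>x - x', u\<rangle>\<close> has second moment \<open>O(\<bar>u\<bar>\<^sup>2)\<close> for every fixed \<open>u\<close>, and by the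
  Donsker-Varadhan inequality \<open>\<langle>x, x'\<rangle> \<le> 0.4 n\<close> with constant probability. For uniform \<open>y\<close>, the
  event \<open>\<bar>\<langle>x - x', y\<rangle>\<bar> > 2 B \<surd>n\<close>, which forces one of the two inner products to be large, therefore
  has probability about \<open>exp (- 4 B\<^sup>2 / 2.4)\<close>, which beats \<open>\<theta>\<close>. A smoothed version of this
  probability is, by the second moment bound, a Lipschitz function of \<open>y / \<surd>n\<close>, so it is
  concentrated, and its expectation hardly changes when \<open>y\<close> is drawn from \<open>\<beta>\<close> instead.

  Large rectangles are the case of uniform distributions on sets. For a protocol, the input
  conditioned on the transcript and the public coins is a product distribution, and the information
  cost is its expected relative entropy; if it were small, then most transcripts with output \<open>1\<close>
  would have error more than \<open>\<theta>\<close>.\<close>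

section \<open>Sums over the cube\<close>

lemma cube_0 [simp]: "cube 0 = {[]}"
  by (auto simp: cube_def)

lemma cube_Suc: "cube (Suc n) = Cons 1 ` cube n \<union> Cons (-1) ` cube n"
proof -
  have "x \<in> cube (Suc n) \<longleftrightarrow> x \<in> Cons 1 ` cube n \<union> Cons (-1) ` cube n" for x
    by (cases x) (auto simp: cube_def)
  then show ?thesis by blast
qed

lemma finite_cube [simp, intro]: "finite (cube n)"
  by (induction n) (auto simp: cube_Suc)

lemma sum_cube_Suc:
  fixes f :: "int list \<Rightarrow> 'a :: comm_monoid_add"
  shows "(\<Sum>x\<in>cube (Suc n). f x) = (\<Sum>x\<in>cube n. f (1 # x) + f (-1 # x))"
proof -
  have "(\<Sum>x\<in>cube (Suc n). f x) = (\<Sum>x\<in>Cons 1 ` cube n. f x) + (\<Sum>x\<in>Cons (-1) ` cube n. f x)"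
    unfolding cube_Suc by (rule sum.union_disjoint) auto
  then show ?thesis
    by (simp add: sum.reindex sum.distrib)
qed

lemma card_cube: "card (cube n) = 2 ^ n"
proof (induction n)
  case (Suc n)
  have "card (cube (Suc n)) = (\<Sum>x\<in>cube n. 2)"
    using sum_cube_Suc[of "\<lambda>_. 1 :: nat" n] by simp
  then show ?case using Suc by simp
qed simp

lemma card_cube_pos: "card (cube n) > 0"
  by (simp add: card_cube)

lemma cube_nonempty: "cube n \<noteq> {}"
  using card_cube_pos[of n] by auto

lemma cube_nth: "x \<in> cube n \<Longrightarrow> i < n \<Longrightarrow> x ! i = 1 \<or> x ! i = -1"
  unfolding cube_def using nth_mem[of i x] by blast

lemma sum_cube_prod:
  fixes g :: "nat \<Rightarrow> int \<Rightarrow> real"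
  shows "(\<Sum>x\<in>cube n. \<Prod>i<n. g i (x ! i)) = (\<Prod>i<n. g i 1 + g i (-1))"
proof (induction n arbitrary: g)
  case (Suc n)
  have "(\<Sum>x\<in>cube (Suc n). \<Prod>i<Suc n. g i (x ! i))
      = (\<Sum>x\<in>cube n. (g 0 1 + g 0 (-1)) * (\<Prod>i<n. g (Suc i) (x ! i)))"
    unfolding sum_cube_Suc prod.lessThan_Suc_shift
    by (intro sum.cong refl) (simp add: algebra_simps)
  also have "\<dots> = (g 0 1 + g 0 (-1)) * (\<Prod>i<n. g (Suc i) 1 + g (Suc i) (-1))"
    by (simp add: sum_distrib_left [symmetric] Suc.IH[of "\<lambda>i. g (Suc i)"])
  finally show ?case
    by (simp only: prod.lessThan_Suc_shift)
qed simp

lemma sum_cube_prod_eq_1: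
  fixes p :: "nat \<Rightarrow> int \<Rightarrow> real"
  assumes "\<And>i. i < n \<Longrightarrow> p i 1 + p i (-1) = 1"
  shows "(\<Sum>x\<in>cube n. \<Prod>i<n. p i (x ! i)) = 1"
  using assms by (simp add: sum_cube_prod)

text \<open>Under the product weight the \<open>g i (x ! i)\<close> are independent and centred, so
  the cross terms vanish and the second moments add up.\<close>

lemma product_measure_variance:
  fixes p g :: "nat \<Rightarrow> int \<Rightarrow> real"
  assumes "\<And>i. i < n \<Longrightarrow> p i 1 + p i (-1) = 1"
    and "\<And>i. i < n \<Longrightarrow> p i 1 * g i 1 + p i (-1) * g i (-1) = 0"
  shows "(\<Sum>x\<in>cube n. (\<Prod>i<n. p i (x ! i)) * (\<Sum>i<n. g i (x ! i))\<^sup>2)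
       = (\<Sum>i<n. p i 1 * (g i 1)\<^sup>2 + p i (-1) * (g i (-1))\<^sup>2)"
  using assms
proof (induction n arbitrary: p g)
  case (Suc n)
  let ?P = "\<lambda>x. \<Prod>i<n. p (Suc i) (x ! i)" and ?S = "\<lambda>x. \<Sum>i<n. g (Suc i) (x ! i)"
  let ?v = "p 0 1 * (g 0 1)\<^sup>2 + p 0 (-1) * (g 0 (-1))\<^sup>2"
  have *: "(\<Sum>x\<in>cube n. ?P x) = 1"
    using Suc.prems by (intro sum_cube_prod_eq_1) auto
  have "(\<Sum>x\<in>cube (Suc n). (\<Prod>i<Suc n. p i (x ! i)) * (\<Sum>i<Suc n. g i (x ! i))\<^sup>2)
      = (\<Sum>x\<in>cube n. ?v * ?P x + (2 * (p 0 1 * g 0 1 + p 0 (-1) * g 0 (-1)) * (?P x * ?S x)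
          + (p 0 1 + p 0 (-1)) * (?P x * (?S x)\<^sup>2)))"
    unfolding sum_cube_Suc prod.lessThan_Suc_shift sum.lessThan_Suc_shift
    by (intro sum.cong refl) (simp add: algebra_simps power2_eq_square)
  also have "\<dots> = ?v + (\<Sum>x\<in>cube n. ?P x * (?S x)\<^sup>2)"
    using Suc.prems[of 0] by (simp add: sum.distrib sum_distrib_left[symmetric] *)
  also have "(\<Sum>x\<in>cube n. ?P x * (?S x)\<^sup>2)
      = (\<Sum>i<n. p (Suc i) 1 * (g (Suc i) 1)\<^sup>2 + p (Suc i) (-1) * (g (Suc i) (-1))\<^sup>2)"
    using Suc.prems by (intro Suc.IH) auto
  finally show ?case
    by (simp only: sum.lessThan_Suc_shift)
qed simp

section \<open>Entropy and moment generating functions\<close>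

text \<open>With \<open>S\<close> normalising the tilted weight \<open>q x * exp (f x)\<close>, this
  is nonnegativity of the relative entropy of \<open>p\<close> to that weight. It follows termwise
  from ln t \<le> t - 1; terms with \<open>p x = 0\<close> vanish on the left.\<close>

lemma donsker_varadhan:
  fixes p q f :: "'a \<Rightarrow> real"
  assumes "finite A" and p: "\<And>x. x \<in> A \<Longrightarrow> p x \<ge> 0" and p1: "sum p A = 1"
    and q: "\<And>x. x \<in> A \<Longrightarrow> q x > 0"
  shows "(\<Sum>x\<in>A. p x * f x) \<le> (\<Sum>x\<in>A. p x * ln (p x / q x)) + ln (\<Sum>x\<in>A. q x * exp (f x))"
proof -
  define S where "S = (\<Sum>x\<in>A. q x * exp (f x))"
  have "A \<noteq> {}" using p1 by auto
  then have S: "S > 0"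
    unfolding S_def using assms by (intro sum_pos) auto
  have "p x * (f x - ln (p x / q x) - ln S) \<le> q x * exp (f x) / S - p x" if "x \<in> A" for x
  proof (cases "p x = 0")
    case True
    then show ?thesis using q[OF that] S by simp
  next
    case False
    with p[OF that] have px: "p x > 0" by simp
    let ?t = "q x * exp (f x) / (S * p x)"
    have "f x - ln (p x / q x) - ln S = ln ?t"
      using px q[OF that] S by (simp add: ln_div ln_mult)
    also have "\<dots> \<le> ?t - 1"
      using px q[OF that] S by (intro ln_le_minus_one) auto
    finally have "p x * (f x - ln (p x / q x) - ln S) \<le> p x * (?t - 1)"
      using px by simp
    also have "\<dots> = q x * exp (f x) / S - p x"
      using px S by (simp add: field_simps)
    finally show ?thesis .
  qed
  then have "(\<Sum>x\<in>A. p x * (f x - ln (p x / q x) - ln S)) \<le> (\<Sum>x\<in>A. q x * exp (f x) / S - p x)"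
    by (rule sum_mono)
  also have "\<dots> = 0"
    using S p1 by (simp add: sum_subtractf sum_divide_distrib[symmetric] S_def[symmetric])
  also have "(\<Sum>x\<in>A. p x * (f x - ln (p x / q x) - ln S))
      = (\<Sum>x\<in>A. p x * f x) - (\<Sum>x\<in>A. p x * ln (p x / q x)) - ln S * sum p A"
    by (simp add: algebra_simps sum_subtractf sum.distrib sum_distrib_left)
  finally show ?thesis
    using p1 by (simp add: S_def)
qed

text \<open>Hoeffding's lemma for a random sign with mean \<open>m\<close>.\<close>

lemma biased_sign_mgf_le:
  fixes m t :: real
  assumes "t \<ge> 0" "\<bar>m\<bar> \<le> 1"
  shows "(1 + m) / 2 * exp t + (1 - m) / 2 * exp (- t) \<le> exp (m * t + t\<^sup>2 / 2)"
proof -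
  let ?p = "(1 + m) / 2"
  have pos: "1 + ?p * (exp (2 * t) - 1) > 0"
    using assms by (intro add_pos_nonneg mult_nonneg_nonneg) auto
  \<comment> \<open>A sign is twice a 0-1 variable with success probability \<open>?p\<close>, minus
    one; hence the doubled parameter.\<close>
  have "- (2 * t) * ?p + ln (1 + ?p * (exp (2 * t) - 1)) \<le> (2 * t)\<^sup>2 / 8"
    using assms by (intro Hoeffdings_lemma_aux) auto
  then have "ln (1 + ?p * (exp (2 * t) - 1)) \<le> t + m * t + t\<^sup>2 / 2"
    by (simp add: field_simps power2_eq_square)
  then have "1 + ?p * (exp (2 * t) - 1) \<le> exp (t + (m * t + t\<^sup>2 / 2))"
    using pos by (metis add.assoc exp_le_cancel_iff exp_ln)
  then have "exp (- t) * (1 + ?p * (exp (2 * t) - 1)) \<le> exp (- t) * exp (t + (m * t + t\<^sup>2 / 2))"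
    by simp
  moreover have "exp (- t) * exp (2 * t) = exp t" "exp (- t) * exp (t + (m * t + t\<^sup>2 / 2)) = exp (m * t + t\<^sup>2 / 2)"
    by (simp_all add: exp_add[symmetric])
  ultimately show ?thesis
    by (simp add: field_simps)
qed

lemma cosh_le_exp_half_square: "cosh t \<le> exp (t\<^sup>2 / 2)" for t :: real
  using biased_sign_mgf_le[of "\<bar>t\<bar>" 0] by (cases "t \<ge> 0") (simp_all add: cosh_def field_simps)

text \<open>Half-angle formula: 2 cosh t - 2 is the square of exp s - exp (-s) for s = |t| / 2. That
  difference is at least \<open>w - 1 / w\<close>, hence at least 2 s, where \<open>w\<close> is the
  quadratic Taylor polynomial of exp at s.\<close>

lemma cosh_ge_one_plus_half_square: "cosh t \<ge> 1 + t\<^sup>2 / 2" for t :: real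
proof -
  define s where "s = \<bar>t\<bar> / 2"
  define w where "w = 1 + s + s\<^sup>2 / 2"
  have s: "s \<ge> 0" and w: "w > 0"
    by (auto simp: s_def w_def intro!: add_pos_nonneg)
  have "2 * s * w + s ^ 4 / 4 = w\<^sup>2 - 1"
    by (simp add: w_def field_simps power2_eq_square power4_eq_xxxx)
  then have "2 * s * w \<le> w\<^sup>2 - 1"
    using zero_le_power[OF s, of 4] by linarith
  then have "2 * s \<le> w - 1 / w"
    using w by (simp add: field_simps power2_eq_square)
  also have "w \<le> exp s"
    unfolding w_def using s by (rule exp_lower_Taylor_quadratic)
  then have "w - 1 / w \<le> exp s - exp (- s)"
    using w by (intro diff_mono) (auto simp: exp_minus field_simps)
  finally have "(2 * s)\<^sup>2 \<le> (exp s - exp (- s))\<^sup>2"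
    using s by (intro power_mono) auto
  also have "\<dots> = exp (2 * s) + exp (- (2 * s)) - 2"
    by (simp add: power2_diff flip: exp_add exp_double)
  also have "\<dots> = 2 * cosh t - 2"
    by (cases "t \<ge> 0") (simp_all add: s_def cosh_def)
  finally show ?thesis
    by (simp add: s_def)
qed

lemma cosh_ge_exp:
  fixes t :: real
  assumes "\<bar>t\<bar> \<le> 1"
  shows "cosh t \<ge> exp (t\<^sup>2 / 2 - t ^ 4 / 4)"
proof -
  have sq: "t\<^sup>2 \<le> 1"
    using assms by (simp add: abs_square_le_1)
  have "cosh t \<ge> 1 + t\<^sup>2 / 2"
    by (rule cosh_ge_one_plus_half_square)
  \<comment> \<open>The bound ln (1 + a) \<ge> a - a * a at half the square of t; its quadratic term
    is the quartic loss in the claim.\<close>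
  moreover have "t\<^sup>2 / 2 - (t\<^sup>2 / 2)\<^sup>2 \<le> ln (1 + t\<^sup>2 / 2)"
    using sq by (intro ln_one_plus_pos_lower_bound) auto
  then have "exp (t\<^sup>2 / 2 - (t\<^sup>2 / 2)\<^sup>2) \<le> 1 + t\<^sup>2 / 2"
    by (metis add_pos_nonneg exp_le_cancel_iff exp_ln zero_le_divide_iff zero_le_numeral zero_le_power2 zero_less_one)
  moreover have "(t\<^sup>2 / 2)\<^sup>2 = t ^ 4 / 4"
    by (simp add: power2_eq_square power4_eq_xxxx)
  ultimately show ?thesis by simp
qed

text \<open>McDiarmid's argument, averaging out one coordinate at a time. The average
  \<open>H\<close> inherits the bounded differences, and the two values of \<open>G\<close> lie at
  \<open>H x\<close> plus and minus \<open>d\<close> with |d| \<le> c / 2, which costs a factor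
  \<open>cosh (l * d)\<close>.\<close>

lemma bounded_differences_mgf:
  fixes G :: "int list \<Rightarrow> real"
  assumes "\<And>x i. x \<in> cube n \<Longrightarrow> i < n \<Longrightarrow> \<bar>G (x[i := 1]) - G (x[i := -1])\<bar> \<le> c"
  shows "(\<Sum>x\<in>cube n. exp (l * G x)) \<le> 2 ^ n * exp (l * (\<Sum>x\<in>cube n. G x) / 2 ^ n + n * (l\<^sup>2 * c\<^sup>2 / 8))"
  using assms
proof (induction n arbitrary: G)
  case (Suc n)
  define H where "H x = (G (1 # x) + G (-1 # x)) / 2" for x
  have mem: "1 # x \<in> cube (Suc n)" "-1 # x \<in> cube (Suc n)" if "x \<in> cube n" for x
    using that by (auto simp: cube_Suc)
  have H: "\<bar>H (x[i := 1]) - H (x[i := -1])\<bar> \<le> c" if "x \<in> cube n" "i < n" for x i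
  proof -
    have "\<bar>G (1 # x[i := 1]) - G (1 # x[i := -1])\<bar> \<le> c" "\<bar>G (-1 # x[i := 1]) - G (-1 # x[i := -1])\<bar> \<le> c"
      using Suc.prems[OF mem(1)[OF that(1)], of "Suc i"] Suc.prems[OF mem(2)[OF that(1)], of "Suc i"] that
      by simp_all
    moreover have "\<bar>a - b\<bar> \<le> c \<Longrightarrow> \<bar>a' - b'\<bar> \<le> c \<Longrightarrow> \<bar>(a + a') / 2 - (b + b') / 2\<bar> \<le> c" for a b a' b' :: real
      by (simp add: abs_le_iff field_simps)
    ultimately show ?thesis
      unfolding H_def by blast
  qed
  have "exp (l * G (1 # x)) + exp (l * G (-1 # x)) \<le> 2 * exp (l\<^sup>2 * c\<^sup>2 / 8) * exp (l * H x)"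
    if x: "x \<in> cube n" for x
  proof -
    define d where "d = (G (1 # x) - G (-1 # x)) / 2"
    have "\<bar>d\<bar> \<le> c / 2"
      using Suc.prems[OF mem(1)[OF x], of 0] by (simp add: d_def)
    then have "d\<^sup>2 \<le> (c / 2)\<^sup>2"
      by (intro power2_le_iff_abs_le[THEN iffD2]) auto
    then have "l\<^sup>2 * d\<^sup>2 \<le> l\<^sup>2 * (c / 2)\<^sup>2"
      by (intro mult_left_mono) auto
    then have le: "(l * d)\<^sup>2 / 2 \<le> l\<^sup>2 * c\<^sup>2 / 8"
      by (simp add: power_mult_distrib power_divide mult_ac)
    have e: "l * G (1 # x) = l * H x + l * d" "l * G (-1 # x) = l * H x + - (l * d)"
      by (simp_all add: H_def d_def field_simps)
    have "exp (l * G (1 # x)) + exp (l * G (-1 # x)) = 2 * exp (l * H x) * cosh (l * d)"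
      unfolding e exp_add by (simp add: cosh_def algebra_simps)
    also have "cosh (l * d) \<le> exp (l\<^sup>2 * c\<^sup>2 / 8)"
      using cosh_le_exp_half_square[of "l * d"] le by (meson exp_le_cancel_iff order_trans)
    finally show ?thesis
      by (simp add: mult_ac)
  qed
  then have "(\<Sum>x\<in>cube (Suc n). exp (l * G x)) \<le> (\<Sum>x\<in>cube n. 2 * exp (l\<^sup>2 * c\<^sup>2 / 8) * exp (l * H x))"
    unfolding sum_cube_Suc by (rule sum_mono)
  also have "\<dots> = 2 * exp (l\<^sup>2 * c\<^sup>2 / 8) * (\<Sum>x\<in>cube n. exp (l * H x))"
    by (simp add: sum_distrib_left)
  also have "\<dots> \<le> 2 * exp (l\<^sup>2 * c\<^sup>2 / 8) *
      (2 ^ n * exp (l * (\<Sum>x\<in>cube n. H x) / 2 ^ n + n * (l\<^sup>2 * c\<^sup>2 / 8)))"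
    by (intro mult_left_mono Suc.IH H) auto
  also have "\<dots> = 2 ^ Suc n * exp (l * (\<Sum>x\<in>cube (Suc n). G x) / 2 ^ Suc n + Suc n * (l\<^sup>2 * c\<^sup>2 / 8))"
    unfolding sum_cube_Suc H_def sum_divide_distrib[symmetric]
    by (simp add: exp_add[symmetric] algebra_simps)
  finally show ?case .
qed simp

section \<open>Exponential moments of Rademacher sums\<close>

lemma rademacher_mgf:
  fixes v :: "nat \<Rightarrow> real"
  shows "(\<Sum>y\<in>cube n. exp (t * (\<Sum>i<n. v i * real_of_int (y ! i)))) = 2 ^ n * (\<Prod>i<n. cosh (t * v i))"
proof -
  have "(\<Sum>y\<in>cube n. exp (t * (\<Sum>i<n. v i * real_of_int (y ! i))))
      = (\<Sum>y\<in>cube n. \<Prod>i<n. exp (t * v i * real_of_int (y ! i)))"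
    by (simp add: exp_sum sum_distrib_left mult.assoc)
  also have "\<dots> = (\<Prod>i<n. exp (t * v i) + exp (- (t * v i)))"
    by (simp add: sum_cube_prod[where g = "\<lambda>i a. exp (t * v i * real_of_int a)"])
  also have "\<dots> = (\<Prod>i<n. 2 * cosh (t * v i))"
    by (simp add: cosh_def add_divide_distrib)
  finally show ?thesis
    by (simp add: prod.distrib)
qed

lemma rademacher_mgf_le:
  fixes v :: "nat \<Rightarrow> real"
  shows "(\<Sum>y\<in>cube n. exp (t * (\<Sum>i<n. v i * real_of_int (y ! i)))) \<le> 2 ^ n * exp (t\<^sup>2 * (\<Sum>i<n. (v i)\<^sup>2) / 2)"
proof -
  have "(\<Prod>i<n. cosh (t * v i)) \<le> (\<Prod>i<n. exp ((t * v i)\<^sup>2 / 2))"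
    by (intro prod_mono conjI cosh_le_exp_half_square) (simp add: cosh_real_nonneg)
  also have "\<dots> = exp (t\<^sup>2 * (\<Sum>i<n. (v i)\<^sup>2) / 2)"
    by (simp add: exp_sum[symmetric] power_mult_distrib sum_distrib_left sum_divide_distrib)
  finally show ?thesis
    by (simp add: rademacher_mgf)
qed

lemma rademacher_mgf_ge:
  fixes v :: "nat \<Rightarrow> real"
  assumes "\<And>i. i < n \<Longrightarrow> \<bar>v i\<bar> \<le> 1" "\<bar>t\<bar> \<le> 1"
  shows "2 ^ n * exp (t\<^sup>2 * (\<Sum>i<n. (v i)\<^sup>2) / 2 - n * t ^ 4 / 4)
    \<le> (\<Sum>y\<in>cube n. exp (t * (\<Sum>i<n. v i * real_of_int (y ! i))))"
proof -
  have "exp (t\<^sup>2 * (\<Sum>i<n. (v i)\<^sup>2) / 2 - n * t ^ 4 / 4) = (\<Prod>i<n. exp ((t * v i)\<^sup>2 / 2 - t ^ 4 / 4))"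
    by (simp add: exp_sum[symmetric] power_mult_distrib sum_distrib_left sum_divide_distrib sum_subtractf)
  also have "\<dots> \<le> (\<Prod>i<n. cosh (t * v i))"
  proof (intro prod_mono conjI)
    fix i assume "i \<in> {..<n}"
    then have v: "\<bar>v i\<bar> \<le> 1" using assms by auto
    have "\<bar>t * v i\<bar> \<le> \<bar>t\<bar>"
      using v by (simp add: abs_mult mult_left_le)
    then have "\<bar>t * v i\<bar> ^ 4 \<le> \<bar>t\<bar> ^ 4"
      by (intro power_mono) auto
    then have "exp ((t * v i)\<^sup>2 / 2 - t ^ 4 / 4) \<le> exp ((t * v i)\<^sup>2 / 2 - (t * v i) ^ 4 / 4)"
      by (simp add: power_even_abs)
    also have "\<dots> \<le> cosh (t * v i)"
      using \<open>\<bar>t * v i\<bar> \<le> \<bar>t\<bar>\<close> assms(2) by (intro cosh_ge_exp) linarith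
    finally show "exp ((t * v i)\<^sup>2 / 2 - t ^ 4 / 4) \<le> cosh (t * v i)" .
  qed simp
  finally show ?thesis
    by (simp add: rademacher_mgf)
qed

text \<open>Exponential tilting: under the weight \<open>exp (t * S)\<close> the sum \<open>S\<close> is within \<open>2 * sqrt n\<close> of
  its tilted mean with constant probability, which is seen from the moment generating function at
  \<open>t - h\<close> and \<open>t + h\<close>.\<close>

lemma rademacher_lower_tail:
  fixes v :: "nat \<Rightarrow> real" and s \<eta> :: real
  assumes v: "\<And>i. i < n \<Longrightarrow> \<bar>v i\<bar> \<le> 1" and n: "n > 0" and s: "s \<ge> 0" "s ^ 4 \<le> n"
    and \<eta>: "(\<Sum>i<n. (v i)\<^sup>2) = \<eta> * n"
  shows "1 / 4 * exp (- (\<eta> * s\<^sup>2 / 2) - 2 * s) * 2 ^ n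
    \<le> card {y\<in>cube n. (\<Sum>i<n. v i * real_of_int (y ! i)) \<ge> (\<eta> * s - 2) * sqrt n}"
proof -
  define r where "r = sqrt n"
  define S where "S y = (\<Sum>i<n. v i * real_of_int (y ! i))" for y
  \<comment> \<open>The tilt \<open>t\<close> moves the mean of \<open>S\<close> to about \<eta> * s
    * r; \<open>L\<close> and \<open>U\<close> lie \<open>2 * r\<close> below and above this value.
    The secondary tilt \<open>h\<close> serves for the Chernoff bounds on the two sides.\<close>
  define L where "L = (\<eta> * s - 2) * r"
  define U where "U = (\<eta> * s + 2) * r"
  define t where "t = s / r"
  define h where "h = 2 / r"
  have r: "r > 0" "r\<^sup>2 = n"
    using n by (auto simp: r_def)
  define N where "N = card {y\<in>cube n. S y \<ge> L}"
  have "(\<Sum>i<n. (v i)\<^sup>2) \<le> (\<Sum>i<n. 1)"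
    using v by (intro sum_mono) (simp add: abs_square_le_1)
  then have \<eta>1: "\<eta> \<le> 1"
    using n by (simp add: \<eta>)
  have r4: "r ^ 4 = (real n)\<^sup>2"
    using r(2) by (metis numeral_Bit0 power_add power2_eq_square)
  have "s \<le> r"
  proof (rule power_le_imp_le_base[of s 3 r])
    have "s ^ 4 \<le> r ^ 4"
    proof -
      have "real n \<le> (real n)\<^sup>2"
        using n by (simp add: power2_eq_square)
      then show ?thesis
        using s(2) r4 by linarith
    qed
    then show "s ^ Suc 3 \<le> r ^ Suc 3" by simp
  qed (use r in simp)
  then have t1: "\<bar>t\<bar> \<le> 1"
    using r s by (simp add: t_def)
  \<comment> \<open>This keeps the quartic loss in the lower bound for the moment generating
    function to a factor \<open>exp (- 1 / 4)\<close>.\<close>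
  have t4: "n * t ^ 4 \<le> 1"
    using s(2) n by (simp add: t_def power_divide r4 power2_eq_square divide_le_eq)
  \<comment> \<open>Below \<open>L\<close> the tilt \<open>t - h\<close> dominates, above
    \<open>U\<close> the tilt \<open>t + h\<close> does, and in the window the weight is at most
    \<open>exp (t * U)\<close>.\<close>
  have point: "exp (t * S y) \<le> exp (h * L) * exp ((t - h) * S y) + exp (- h * U) * exp ((t + h) * S y)
      + exp (t * U) * (if S y \<ge> L then 1 else 0)" for y
  proof -
    consider "S y < L" | "S y > U" | "L \<le> S y" "S y \<le> U" by linarith
    then show ?thesis
    proof cases
      case 1
      then have "h * S y \<le> h * L" using r by (intro mult_left_mono) (auto simp: h_def)
      then have "t * S y \<le> h * L + (t - h) * S y" by (simp add: algebra_simps)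
      then have "exp (t * S y) \<le> exp (h * L) * exp ((t - h) * S y)" by (simp add: exp_add[symmetric])
      then show ?thesis using 1 by (simp add: add_increasing2)
    next
      case 2
      then have "h * U \<le> h * S y" using r by (intro mult_left_mono) (auto simp: h_def)
      then have "t * S y \<le> - h * U + (t + h) * S y" by (simp add: algebra_simps)
      then have "exp (t * S y) \<le> exp (- h * U) * exp ((t + h) * S y)" by (simp add: exp_add[symmetric])
      then show ?thesis by (simp add: add_increasing add_increasing2)
    next
      case 3
      then have "t * S y \<le> t * U" using r s by (intro mult_left_mono) (auto simp: t_def)
      then show ?thesis using 3 by (simp add: add_increasing)
    qed
  qed
  have V: "(a / r)\<^sup>2 * (\<Sum>i<n. (v i)\<^sup>2) / 2 = \<eta> * a\<^sup>2 / 2" for a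
    using r n by (simp add: \<eta> power_divide field_simps)
  have hr: "h * (a * r) = 2 * a" "t * (a * r) = s * a" for a
    using r by (simp_all add: h_def t_def)
  have th: "t - h = (s - 2) / r" "t + h = (s + 2) / r"
    by (simp_all add: t_def h_def diff_divide_distrib add_divide_distrib)
  let ?E = "exp (\<eta> * s\<^sup>2 / 2)"
  have "2 ^ n * (?E * exp (- 1 / 4)) = 2 ^ n * exp (\<eta> * s\<^sup>2 / 2 - 1 / 4)"
    by (simp add: exp_add[symmetric])
  also have "\<dots> \<le> 2 ^ n * exp (t\<^sup>2 * (\<Sum>i<n. (v i)\<^sup>2) / 2 - n * t ^ 4 / 4)"
    using t4 by (simp add: t_def V)
  also have "\<dots> \<le> (\<Sum>y\<in>cube n. exp (t * S y))"
    unfolding S_def using v t1 by (rule rademacher_mgf_ge)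
  also have "\<dots> \<le> (\<Sum>y\<in>cube n. exp (h * L) * exp ((t - h) * S y) + exp (- h * U) * exp ((t + h) * S y)
      + exp (t * U) * (if S y \<ge> L then 1 else 0))"
    by (intro sum_mono point)
  also have "\<dots> = exp (h * L) * (\<Sum>y\<in>cube n. exp ((t - h) * S y))
      + exp (- h * U) * (\<Sum>y\<in>cube n. exp ((t + h) * S y)) + exp (t * U) * N"
    by (simp add: sum.distrib sum_distrib_left[symmetric] N_def sum.If_cases Int_def)
  also have "\<dots> \<le> exp (h * L) * (2 ^ n * exp ((t - h)\<^sup>2 * (\<Sum>i<n. (v i)\<^sup>2) / 2))
      + exp (- h * U) * (2 ^ n * exp ((t + h)\<^sup>2 * (\<Sum>i<n. (v i)\<^sup>2) / 2)) + exp (t * U) * N"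
    unfolding S_def by (intro add_mono mult_left_mono rademacher_mgf_le) auto
  also have "\<dots> = 2 ^ n * (exp (h * L + (t - h)\<^sup>2 * (\<Sum>i<n. (v i)\<^sup>2) / 2)
      + exp (- h * U + (t + h)\<^sup>2 * (\<Sum>i<n. (v i)\<^sup>2) / 2)) + exp (t * U) * N"
    by (simp only: exp_add distrib_left mult_ac)
  also have "h * L + (t - h)\<^sup>2 * (\<Sum>i<n. (v i)\<^sup>2) / 2 = \<eta> * s\<^sup>2 / 2 + (2 * \<eta> - 4)"
    unfolding th V L_def hr by (simp add: power2_eq_square field_simps)
  also have "- h * U + (t + h)\<^sup>2 * (\<Sum>i<n. (v i)\<^sup>2) / 2 = \<eta> * s\<^sup>2 / 2 + (2 * \<eta> - 4)"
    unfolding th V U_def mult_minus_left hr by (simp add: power2_eq_square field_simps)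
  also have "t * U = \<eta> * s\<^sup>2 / 2 + (\<eta> * s\<^sup>2 / 2 + 2 * s)"
    unfolding U_def hr by (simp add: field_simps power2_eq_square)
  also have "2 ^ n * (exp (\<eta> * s\<^sup>2 / 2 + (2 * \<eta> - 4)) + exp (\<eta> * s\<^sup>2 / 2 + (2 * \<eta> - 4)))
        + exp (\<eta> * s\<^sup>2 / 2 + (\<eta> * s\<^sup>2 / 2 + 2 * s)) * N
      = ?E * (2 ^ n * (2 * exp (2 * \<eta> - 4)) + exp (\<eta> * s\<^sup>2 / 2 + 2 * s) * N)"
    by (simp only: exp_add) (simp add: algebra_simps)
  finally have "?E * (2 ^ n * exp (- 1 / 4)) \<le> ?E * (2 ^ n * (2 * exp (2 * \<eta> - 4)) + exp (\<eta> * s\<^sup>2 / 2 + 2 * s) * N)"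
    by (simp add: mult_ac)
  then have main: "2 ^ n * exp (- 1 / 4) \<le> 2 ^ n * (2 * exp (2 * \<eta> - 4)) + exp (\<eta> * s\<^sup>2 / 2 + 2 * s) * N"
    by simp
  \<comment> \<open>Relative to \<open>?E\<close>, the two sides together carry at most 2/5 of the
    tilted mass and the whole carries at least 3/4, so more than 1/4 is left for the window.\<close>
  have "exp (2 * \<eta> - 4) \<le> exp (- 2 :: real)"
    using \<eta>1 by simp
  also have "\<dots> = 1 / exp 2"
    by (simp add: exp_minus field_simps)
  also have "\<dots> \<le> 1 / 5"
    using exp_lower_Taylor_quadratic[of "2 :: real"] by (intro divide_left_mono) auto
  finally have e1: "2 * exp (2 * \<eta> - 4) \<le> 2 / 5" by simp
  have e2: "3 / 4 \<le> exp (- 1 / 4 :: real)"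
    using exp_ge_add_one_self[of "- 1 / 4 :: real"] by simp
  have "2 ^ n * (1 / 4) \<le> 2 ^ n * (exp (- 1 / 4) - 2 * exp (2 * \<eta> - 4))"
    using e1 e2 by (intro mult_left_mono) auto
  also have "\<dots> \<le> exp (\<eta> * s\<^sup>2 / 2 + 2 * s) * N"
    using main by (simp add: algebra_simps)
  finally have "exp (- (\<eta> * s\<^sup>2 / 2 + 2 * s)) * (2 ^ n * (1 / 4)) \<le> exp (- (\<eta> * s\<^sup>2 / 2 + 2 * s)) * (exp (\<eta> * s\<^sup>2 / 2 + 2 * s) * N)"
    by (intro mult_left_mono) auto
  also have "\<dots> = N"
    by (simp add: mult.assoc[symmetric] exp_add[symmetric])
  finally have "exp (- (\<eta> * s\<^sup>2 / 2) - 2 * s) * (2 ^ n * (1 / 4)) \<le> N"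
    by (simp only: minus_add_distrib diff_conv_add_uminus)
  then show ?thesis
    by (simp add: N_def S_def L_def r_def mult_ac)
qed

section \<open>A decorrelated coupling\<close>

definition dot :: "nat \<Rightarrow> int list \<Rightarrow> int list \<Rightarrow> real" where
  "dot n x y = (\<Sum>i<n. real_of_int (x ! i) * real_of_int (y ! i))"

text \<open>The relative entropy of \<alpha> with respect to the uniform distribution on the cube,
  in nats.\<close>

definition relent :: "nat \<Rightarrow> (int list \<Rightarrow> real) \<Rightarrow> real" where
  "relent n \<alpha> = (\<Sum>x\<in>cube n. \<alpha> x * ln (2 ^ n * \<alpha> x))"

definition prob_fun :: "nat \<Rightarrow> (int list \<Rightarrow> real) \<Rightarrow> bool" where
  "prob_fun n \<alpha> \<longleftrightarrow> (\<forall>x\<in>cube n. \<alpha> x \<ge> 0) \<and> (\<Sum>x\<in>cube n. \<alpha> x) = 1"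

lemma relent_donsker_varadhan:
  assumes "prob_fun n \<alpha>"
  shows "(\<Sum>x\<in>cube n. \<alpha> x * f x) \<le> relent n \<alpha> + ln ((\<Sum>x\<in>cube n. exp (f x)) / 2 ^ n)"
proof -
  have "(\<Sum>x\<in>cube n. \<alpha> x * f x)
      \<le> (\<Sum>x\<in>cube n. \<alpha> x * ln (\<alpha> x / (1 / 2 ^ n))) + ln (\<Sum>x\<in>cube n. 1 / 2 ^ n * exp (f x))"
    using assms by (intro donsker_varadhan) (auto simp: prob_fun_def)
  then show ?thesis
    by (simp add: relent_def sum_divide_distrib mult_ac)
qed

lemma relent_nonneg: "prob_fun n \<alpha> \<Longrightarrow> relent n \<alpha> \<ge> 0"
  using relent_donsker_varadhan[of n \<alpha> "\<lambda>_. 0"] by (simp add: card_cube)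

text \<open>The kernel that keeps each coordinate with probability 2/3 and flips it otherwise,
  independently. Given \<open>x\<close>, the observation \<open>z\<close> has mean
  \<open>x / 3\<close>, so \<open>3 * z\<close> is an unbiased estimate of \<open>x\<close>.\<close>

definition noise :: "nat \<Rightarrow> int list \<Rightarrow> int list \<Rightarrow> real" where
  "noise n z x = (\<Prod>i<n. (1 + real_of_int (x ! i) * real_of_int (z ! i) / 3) / 2)"

lemma noise_pos: "x \<in> cube n \<Longrightarrow> z \<in> cube n \<Longrightarrow> noise n z x > 0"
  unfolding noise_def
proof (rule prod_pos, safe)
  fix i assume "x \<in> cube n" "z \<in> cube n" "i < n"
  then show "0 < (1 + real_of_int (x ! i) * real_of_int (z ! i) / 3) / 2"
    using cube_nth[of x n i] cube_nth[of z n i] by auto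
qed

lemma sum_noise: "(\<Sum>z\<in>cube n. noise n z x) = 1"
  unfolding noise_def
  by (rule sum_cube_prod_eq_1[where p = "\<lambda>i a. (1 + real_of_int (x ! i) * real_of_int a / 3) / 2"])
    (simp add: field_simps)

text \<open>Given \<open>x\<close>, each coordinate of \<open>3 * z\<close> has variance 9 - 1 = 8
  around that of \<open>x\<close>, and the coordinates are independent.\<close>

lemma noise_second_moment:
  fixes u :: "nat \<Rightarrow> real"
  assumes "x \<in> cube n"
  shows "(\<Sum>z\<in>cube n. noise n z x * (\<Sum>i<n. u i * (real_of_int (x ! i) - 3 * real_of_int (z ! i)))\<^sup>2)
    = 8 * (\<Sum>i<n. (u i)\<^sup>2)"
proof -
  define p where "p i a = (1 + real_of_int (x ! i) * real_of_int a / 3) / 2" for i a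
  define g where "g i a = u i * (real_of_int (x ! i) - 3 * real_of_int a)" for i a
  have "(\<Sum>z\<in>cube n. (\<Prod>i<n. p i (z ! i)) * (\<Sum>i<n. g i (z ! i))\<^sup>2)
       = (\<Sum>i<n. p i 1 * (g i 1)\<^sup>2 + p i (-1) * (g i (-1))\<^sup>2)"
    by (rule product_measure_variance) (auto simp: p_def g_def field_simps)
  also have "\<dots> = (\<Sum>i<n. 8 * (u i)\<^sup>2)"
  proof (intro sum.cong refl)
    fix i assume "i \<in> {..<n}"
    then show "p i 1 * (g i 1)\<^sup>2 + p i (-1) * (g i (-1))\<^sup>2 = 8 * (u i)\<^sup>2"
      using cube_nth[OF assms, of i] by (auto simp: p_def g_def power2_eq_square)
  qed
  finally show ?thesis
    by (simp add: noise_def p_def g_def sum_distrib_left)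
qed

text \<open>Composing two noise steps multiplies the correlations: 1/3 times 1/3 is 1/9.\<close>

lemma sum_noise_noise:
  "(\<Sum>z\<in>cube n. noise n z x * noise n z x')
    = (\<Prod>i<n. (1 + real_of_int (x ! i) * real_of_int (x' ! i) / 9) / 2)"
proof -
  define g where "g i a = (1 + real_of_int (x ! i) * real_of_int a / 3) / 2 *
    ((1 + real_of_int (x' ! i) * real_of_int a / 3) / 2)" for i a
  have "(\<Sum>z\<in>cube n. noise n z x * noise n z x') = (\<Sum>z\<in>cube n. \<Prod>i<n. g i (z ! i))"
    unfolding noise_def g_def by (simp only: prod.distrib)
  also have "\<dots> = (\<Prod>i<n. g i 1 + g i (-1))"
    by (rule sum_cube_prod)
  also have "\<dots> = (\<Prod>i<n. (1 + real_of_int (x ! i) * real_of_int (x' ! i) / 9) / 2)"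
    by (intro prod.cong refl) (simp add: g_def field_simps)
  finally show ?thesis .
qed

text \<open>After two noise steps from \<open>x\<close>, the products of the coordinates of
  \<open>x\<close> and \<open>x'\<close> are independent signs with mean 1/9.\<close>

lemma noise_noise_mgf:
  assumes x: "x \<in> cube n" and t: "t \<ge> 0"
  shows "(\<Sum>x'\<in>cube n. (\<Sum>z\<in>cube n. noise n z x * noise n z x') * exp (t * dot n x x'))
    \<le> exp (n * (t / 9 + t\<^sup>2 / 2))"
proof -
  define g where "g i a = (1 + real_of_int (x ! i) * real_of_int a / 9) / 2 *
    exp (t * (real_of_int (x ! i) * real_of_int a))" for i a
  have "(\<Sum>x'\<in>cube n. (\<Sum>z\<in>cube n. noise n z x * noise n z x') * exp (t * dot n x x'))
      = (\<Sum>x'\<in>cube n. \<Prod>i<n. g i (x' ! i))"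
    unfolding sum_noise_noise dot_def g_def sum_distrib_left by (simp only: prod.distrib exp_sum[OF finite_lessThan])
  also have "\<dots> = (\<Prod>i<n. g i 1 + g i (-1))"
    by (rule sum_cube_prod)
  also have "\<dots> = (\<Prod>i<n. (1 + 1 / 9) / 2 * exp t + (1 - 1 / 9) / 2 * exp (- t))"
  proof (intro prod.cong refl)
    fix i assume "i \<in> {..<n}"
    then show "g i 1 + g i (-1) = (1 + 1 / 9) / 2 * exp t + (1 - 1 / 9) / 2 * exp (- t)"
      using cube_nth[OF x, of i] by (auto simp: g_def)
  qed
  also have "\<dots> \<le> (\<Prod>i<n. exp (1 / 9 * t + t\<^sup>2 / 2))"
    using t by (intro prod_mono conjI biased_sign_mgf_le add_nonneg_nonneg) auto
  finally show ?thesis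
    by (simp add: exp_of_nat_mult)
qed

text \<open>The coupling draws \<open>x\<close>, a noisy copy \<open>z\<close> of \<open>x\<close>, and \<open>x'\<close> from the posterior given \<open>z\<close>.
  Both \<open>x\<close> and \<open>x'\<close> are close to \<open>3 * z\<close> in every fixed direction, whatever \<open>\<alpha>\<close> is; and if
  \<open>\<alpha>\<close> has small relative entropy, then \<open>x\<close> and \<open>x'\<close> are almost as weakly correlated as for
  uniform \<open>\<alpha>\<close>.\<close>

lemma decorrelated_coupling:
  assumes \<alpha>: "prob_fun n \<alpha>" and ent: "relent n \<alpha> \<le> n / 200"
  obtains Q :: "int list \<Rightarrow> int list \<Rightarrow> real" where
    "\<And>x x'. x \<in> cube n \<Longrightarrow> x' \<in> cube n \<Longrightarrow> Q x x' \<ge> 0"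
    "\<And>x. x \<in> cube n \<Longrightarrow> (\<Sum>x'\<in>cube n. Q x x') = \<alpha> x"
    "\<And>x'. x' \<in> cube n \<Longrightarrow> (\<Sum>x\<in>cube n. Q x x') = \<alpha> x'"
    "\<And>u :: nat \<Rightarrow> real. (\<Sum>x\<in>cube n. \<Sum>x'\<in>cube n. Q x x' *
        (\<Sum>i<n. u i * (real_of_int (x ! i) - real_of_int (x' ! i)))\<^sup>2) \<le> 32 * (\<Sum>i<n. (u i)\<^sup>2)"
    "(\<Sum>x\<in>cube n. \<Sum>x'\<in>cube n. Q x x' * dot n x x') \<le> 3 / 10 * n"
proof -
  note nonneg = \<alpha>[unfolded prob_fun_def, THEN conjunct1, rule_format]
  note total = \<alpha>[unfolded prob_fun_def, THEN conjunct2]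
  \<comment> \<open>\<open>Z\<close> is the law of the observation and \<open>T\<close> the joint
    law of \<open>x\<close>, \<open>x'\<close> and \<open>z\<close>, in which \<open>x\<close> and
    \<open>x'\<close> are conditionally independent given \<open>z\<close>.\<close>
  define Z where "Z z = (\<Sum>x\<in>cube n. \<alpha> x * noise n z x)" for z
  define T where "T x x' z = \<alpha> x * noise n z x * (\<alpha> x' * noise n z x') / Z z" for x x' z
  define Q where "Q x x' = (\<Sum>z\<in>cube n. T x x' z)" for x x'
  have Zpos: "Z z > 0" if "z \<in> cube n" for z
  proof -
    obtain x where x: "x \<in> cube n" "\<alpha> x > 0"
    proof (rule ccontr)
      assume "\<not> thesis"
      with that have "\<forall>x\<in>cube n. \<alpha> x \<le> 0" by (meson not_less)
      then have "(\<Sum>x\<in>cube n. \<alpha> x) \<le> 0" by (intro sum_nonpos) auto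
      then show False using total by simp
    qed
    have "0 < \<alpha> x * noise n z x"
      using x noise_pos that by simp
    also have "\<dots> \<le> Z z"
      unfolding Z_def using x noise_pos[OF _ that] nonneg
      by (intro member_le_sum mult_nonneg_nonneg) (auto intro: less_imp_le)
    finally show ?thesis .
  qed
  have Z1: "(\<Sum>z\<in>cube n. Z z) = 1"
    unfolding Z_def by (subst sum.swap) (simp add: sum_distrib_left[symmetric] sum_noise total)
  have Zprob: "prob_fun n Z"
    using Z1 Zpos by (auto simp: prob_fun_def intro: less_imp_le)
  have Tnn: "T x x' z \<ge> 0" if "x \<in> cube n" "x' \<in> cube n" "z \<in> cube n" for x x' z
    unfolding T_def using that nonneg noise_pos Zpos
    by (intro mult_nonneg_nonneg divide_nonneg_nonneg) (auto intro: less_imp_le)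
  have Tsym: "T x x' z = T x' x z" for x x' z
    by (simp add: T_def mult_ac)
  have T2: "(\<Sum>x'\<in>cube n. T x x' z) = \<alpha> x * noise n z x" if "z \<in> cube n" for x z
    using Zpos[OF that] unfolding T_def
    by (simp add: sum_distrib_left[symmetric] sum_divide_distrib[symmetric] Z_def[symmetric])
  have Q2: "(\<Sum>x'\<in>cube n. Q x x') = \<alpha> x" for x
    unfolding Q_def by (subst sum.swap) (simp add: T2 sum_distrib_left[symmetric] sum_noise)
  have Q3: "(\<Sum>x\<in>cube n. Q x x') = \<alpha> x'" for x'
    unfolding Q2[of x', symmetric] Q_def by (intro sum.cong refl Tsym)
  show thesis
  proof (rule that[of Q, OF _ Q2 Q3])
    show "Q x x' \<ge> 0" if "x \<in> cube n" "x' \<in> cube n" for x x'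
      unfolding Q_def using that by (intro sum_nonneg Tnn)
  next
    fix u :: "nat \<Rightarrow> real"
    \<comment> \<open>Both \<open>x\<close> and \<open>x'\<close> are compared with
      \<open>3 * z\<close>. By symmetry the two squared deviations contribute equally, which gives
      the constant 2 * 8 + 2 * 8 = 32.\<close>
    define s where "s x z = (\<Sum>i<n. u i * (real_of_int (x ! i) - 3 * real_of_int (z ! i)))" for x z
    have diff: "(\<Sum>i<n. u i * (real_of_int (x ! i) - real_of_int (x' ! i))) = s x z - s x' z" for x x' z
      by (simp add: s_def sum_subtractf[symmetric] algebra_simps)
    have sq: "(a - b)\<^sup>2 \<le> 2 * a\<^sup>2 + 2 * b\<^sup>2" for a b :: real
      using zero_le_power2[of "a + b"] by (simp add: power2_eq_square algebra_simps)
    have "(\<Sum>x\<in>cube n. \<Sum>x'\<in>cube n. Q x x' * (\<Sum>i<n. u i * (real_of_int (x ! i) - real_of_int (x' ! i)))\<^sup>2)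
        = (\<Sum>x\<in>cube n. \<Sum>x'\<in>cube n. \<Sum>z\<in>cube n. T x x' z * (s x z - s x' z)\<^sup>2)"
      unfolding Q_def sum_distrib_right
      by (intro sum.cong refl arg_cong2[where f = "(*)"] arg_cong[where f = "\<lambda>a. a\<^sup>2"] diff)
    also have "\<dots> \<le> (\<Sum>x\<in>cube n. \<Sum>x'\<in>cube n. \<Sum>z\<in>cube n. T x x' z * (2 * (s x z)\<^sup>2 + 2 * (s x' z)\<^sup>2))"
      by (intro sum_mono mult_left_mono sq Tnn)
    also have "\<dots> = 2 * (\<Sum>x\<in>cube n. \<Sum>x'\<in>cube n. \<Sum>z\<in>cube n. T x x' z * (s x z)\<^sup>2)
        + 2 * (\<Sum>x\<in>cube n. \<Sum>x'\<in>cube n. \<Sum>z\<in>cube n. T x x' z * (s x' z)\<^sup>2)"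
      by (simp add: sum.distrib sum_distrib_left algebra_simps)
    also have "(\<Sum>x\<in>cube n. \<Sum>x'\<in>cube n. \<Sum>z\<in>cube n. T x x' z * (s x' z)\<^sup>2)
        = (\<Sum>x\<in>cube n. \<Sum>x'\<in>cube n. \<Sum>z\<in>cube n. T x x' z * (s x z)\<^sup>2)"
      by (subst sum.swap, intro sum.cong refl, subst Tsym, rule refl)
    also have "(\<Sum>x\<in>cube n. \<Sum>x'\<in>cube n. \<Sum>z\<in>cube n. T x x' z * (s x z)\<^sup>2)
        = (\<Sum>x\<in>cube n. \<Sum>z\<in>cube n. \<Sum>x'\<in>cube n. T x x' z * (s x z)\<^sup>2)"
      by (intro sum.cong refl sum.swap)
    also have "\<dots> = (\<Sum>x\<in>cube n. \<Sum>z\<in>cube n. \<alpha> x * (noise n z x * (s x z)\<^sup>2))"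
      by (simp add: sum_distrib_right[symmetric] T2 mult.assoc)
    also have "\<dots> = (\<Sum>x\<in>cube n. \<alpha> x * (8 * (\<Sum>i<n. (u i)\<^sup>2)))"
      unfolding sum_distrib_left[symmetric] s_def by (intro sum.cong refl) (simp add: noise_second_moment)
    also have "\<dots> = 8 * (\<Sum>i<n. (u i)\<^sup>2)"
      by (simp add: sum_distrib_right[symmetric] total)
    finally show "(\<Sum>x\<in>cube n. \<Sum>x'\<in>cube n. Q x x' *
        (\<Sum>i<n. u i * (real_of_int (x ! i) - real_of_int (x' ! i)))\<^sup>2) \<le> 32 * (\<Sum>i<n. (u i)\<^sup>2)"
      by simp
  next
    let ?A = "cube n \<times> cube n \<times> cube n"
    define p where "p = (\<lambda>(x, x', z). T x x' z)"
    \<comment> \<open>The law that the triple would have if \<alpha> were uniform; there the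
      correlation of \<open>x\<close> and \<open>x'\<close> is controlled by
      \<open>noise_noise_mgf\<close>.\<close>
    define q where "q = (\<lambda>(x, x', z). noise n z x * noise n z x' / 2 ^ n)"
    define t where "t = (1 / 5 :: real)"
    define f where "f = (\<lambda>(x, x', z :: int list). t * dot n x x')"
    have triple: "sum h ?A = (\<Sum>x\<in>cube n. \<Sum>x'\<in>cube n. \<Sum>z\<in>cube n. h (x, x', z))" for h :: "_ \<Rightarrow> real"
      by (simp add: sum.cartesian_product)
    have dv: "(\<Sum>w\<in>?A. p w * f w) \<le> (\<Sum>w\<in>?A. p w * ln (p w / q w)) + ln (\<Sum>w\<in>?A. q w * exp (f w))"
    proof (rule donsker_varadhan)
      show "sum p ?A = 1"
        unfolding triple p_def prod.case Q_def[symmetric]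
      proof -
        have "(\<Sum>x\<in>cube n. \<Sum>x'\<in>cube n. Q x x') = (\<Sum>x\<in>cube n. \<Sum>z\<in>cube n. \<Sum>x'\<in>cube n. T x x' z)"
          unfolding Q_def by (intro sum.cong refl sum.swap)
        then show "(\<Sum>x\<in>cube n. \<Sum>x'\<in>cube n. Q x x') = 1"
          by (simp add: T2 sum_distrib_left[symmetric] sum_noise total)
      qed
    qed (auto simp: p_def q_def Tnn noise_pos)
    have lhs: "(\<Sum>w\<in>?A. p w * f w) = t * (\<Sum>x\<in>cube n. \<Sum>x'\<in>cube n. Q x x' * dot n x x')"
      unfolding triple p_def f_def Q_def prod.case sum_distrib_left sum_distrib_right
      by (intro sum.cong refl) (simp add: mult_ac)
    have "(\<Sum>w\<in>?A. q w * exp (f w))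
        = (\<Sum>x\<in>cube n. (\<Sum>x'\<in>cube n. (\<Sum>z\<in>cube n. noise n z x * noise n z x') * exp (t * dot n x x')) / 2 ^ n)"
      unfolding triple q_def f_def by (simp add: sum_distrib_right sum_divide_distrib)
    also have "\<dots> \<le> (\<Sum>x\<in>cube n. exp (n * (t / 9 + t\<^sup>2 / 2)) / 2 ^ n)"
      by (intro sum_mono divide_right_mono noise_noise_mgf) (auto simp: t_def)
    also have "\<dots> = exp (n * (t / 9 + t\<^sup>2 / 2))"
      by (simp add: card_cube)
    finally have mgf: "(\<Sum>w\<in>?A. q w * exp (f w)) \<le> exp (n * (t / 9 + t\<^sup>2 / 2))" .
    have pos: "(\<Sum>w\<in>?A. q w * exp (f w)) > 0"
      using cube_nonempty[of n] by (intro sum_pos) (auto simp: q_def noise_pos)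
    have ln_mgf: "ln (\<Sum>w\<in>?A. q w * exp (f w)) \<le> n * (t / 9 + t\<^sup>2 / 2)"
      using ln_mono[OF mgf pos] by (simp only: ln_exp)
    let ?l = "\<lambda>x. ln (2 ^ n * \<alpha> x)" and ?lZ = "\<lambda>z. ln (2 ^ n * Z z)"
    have "(\<Sum>w\<in>?A. p w * ln (p w / q w))
        = (\<Sum>x\<in>cube n. \<Sum>x'\<in>cube n. \<Sum>z\<in>cube n. T x x' z * (?l x + ?l x' - ?lZ z))"
      unfolding triple
    proof (intro sum.cong refl)
      fix x x' z assume c: "x \<in> cube n" "x' \<in> cube n" "z \<in> cube n"
      show "p (x, x', z) * ln (p (x, x', z) / q (x, x', z)) = T x x' z * (?l x + ?l x' - ?lZ z)"
      proof (cases "T x x' z = 0")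
        case False
        then have "\<alpha> x \<noteq> 0" "\<alpha> x' \<noteq> 0" by (auto simp: T_def)
        with nonneg[OF c(1)] nonneg[OF c(2)] have a: "\<alpha> x > 0" "\<alpha> x' > 0" by auto
        have W: "noise n z x > 0" "noise n z x' > 0" using c noise_pos by auto
        have "p (x, x', z) / q (x, x', z) = (2 ^ n * \<alpha> x) * (2 ^ n * \<alpha> x') / (2 ^ n * Z z)"
          using W Zpos[OF c(3)] by (simp add: p_def q_def T_def field_simps)
        then have "ln (p (x, x', z) / q (x, x', z)) = ?l x + ?l x' - ?lZ z"
          using a Zpos[OF c(3)] by (simp add: ln_div ln_mult)
        then show ?thesis by (simp add: p_def)
      qed (simp add: p_def)
    qed
    also have "\<dots> = (\<Sum>x\<in>cube n. \<Sum>x'\<in>cube n. \<Sum>z\<in>cube n. T x x' z * ?l x)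
        + (\<Sum>x\<in>cube n. \<Sum>x'\<in>cube n. \<Sum>z\<in>cube n. T x x' z * ?l x')
        - (\<Sum>x\<in>cube n. \<Sum>x'\<in>cube n. \<Sum>z\<in>cube n. T x x' z * ?lZ z)"
      by (simp add: sum.distrib sum_subtractf algebra_simps)
    also have "(\<Sum>x\<in>cube n. \<Sum>x'\<in>cube n. \<Sum>z\<in>cube n. T x x' z * ?l x')
        = (\<Sum>x\<in>cube n. \<Sum>x'\<in>cube n. \<Sum>z\<in>cube n. T x x' z * ?l x)"
      by (subst sum.swap, intro sum.cong refl, subst Tsym, rule refl)
    also have "(\<Sum>x\<in>cube n. \<Sum>x'\<in>cube n. \<Sum>z\<in>cube n. T x x' z * ?l x)
        = (\<Sum>x\<in>cube n. \<Sum>z\<in>cube n. \<Sum>x'\<in>cube n. T x x' z * ?l x)"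
      by (intro sum.cong refl sum.swap)
    also have "\<dots> = (\<Sum>x\<in>cube n. \<Sum>z\<in>cube n. \<alpha> x * ?l x * noise n z x)"
      by (intro sum.cong refl) (simp add: sum_distrib_right[symmetric] T2 mult_ac)
    also have "\<dots> = relent n \<alpha>"
      by (simp add: sum_distrib_left[symmetric] sum_noise relent_def)
    also have "(\<Sum>x\<in>cube n. \<Sum>x'\<in>cube n. \<Sum>z\<in>cube n. T x x' z * ?lZ z)
        = (\<Sum>x\<in>cube n. \<Sum>z\<in>cube n. \<Sum>x'\<in>cube n. T x x' z * ?lZ z)"
      by (intro sum.cong refl sum.swap)
    also have "\<dots> = (\<Sum>z\<in>cube n. \<Sum>x\<in>cube n. \<alpha> x * noise n z x * ?lZ z)"
      by (subst sum.swap) (simp add: sum_distrib_right[symmetric] T2)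
    also have "\<dots> = relent n Z"
      unfolding relent_def by (simp add: sum_distrib_right[symmetric] Z_def[symmetric])
    finally have "(\<Sum>w\<in>?A. p w * ln (p w / q w)) \<le> 2 * relent n \<alpha>"
      using relent_nonneg[OF Zprob] by linarith
    with dv lhs ln_mgf ent have "t * (\<Sum>x\<in>cube n. \<Sum>x'\<in>cube n. Q x x' * dot n x x')
        \<le> 2 * (n / 200) + n * (t / 9 + t\<^sup>2 / 2)"
      by linarith
    \<comment> \<open>Dividing by \<open>t\<close> = 1/5 gives the coefficient 5 * (1/100 + 1/45 +
      1/50) < 0.27.\<close>
    then have "(\<Sum>x\<in>cube n. \<Sum>x'\<in>cube n. Q x x' * dot n x x') \<le> 5 * (n / 100 + n * (1 / 45 + 1 / 50))"
      by (simp add: t_def power2_eq_square)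
    then show "(\<Sum>x\<in>cube n. \<Sum>x'\<in>cube n. Q x x' * dot n x x') \<le> 3 / 10 * n"
      by (simp add: field_simps)
  qed
qed

section \<open>Large inner products under product distributions\<close>

definition sqdist :: "nat \<Rightarrow> int list \<Rightarrow> int list \<Rightarrow> real" where
  "sqdist n y y' = (\<Sum>i<n. (real_of_int (y ! i) - real_of_int (y' ! i))\<^sup>2)"

lemma sqdist_update_le:
  assumes y: "y \<in> cube n" "y' \<in> cube n" and i: "i < n" and a: "a = 1 \<or> a = -1"
  shows "sqdist n (y[i := a]) y' \<le> sqdist n (y[i := b]) y' + 4"
proof -
  have len: "length y = n" using y by (simp add: cube_def)
  have "sqdist n (y[i := a]) y'
      \<le> (\<Sum>j<n. (real_of_int (y[i := b] ! j) - real_of_int (y' ! j))\<^sup>2 + (if j = i then 4 else 0))"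
    unfolding sqdist_def
  proof (intro sum_mono)
    fix j assume "j \<in> {..<n}"
    then show "(real_of_int (y[i := a] ! j) - real_of_int (y' ! j))\<^sup>2
        \<le> (real_of_int (y[i := b] ! j) - real_of_int (y' ! j))\<^sup>2 + (if j = i then 4 else 0)"
      using a len i cube_nth[OF y(2), of j] by (cases "j = i") auto
  qed
  also have "\<dots> = sqdist n (y[i := b]) y' + 4"
    using i by (simp add: sum.distrib sqdist_def)
  finally show ?thesis .
qed

text \<open>Replacing \<open>F\<close> by an infimal convolution turns its Euclidean modulus of continuity into
  bounded differences.\<close>

lemma relent_expectation_ge:
  fixes F :: "int list \<Rightarrow> real"
  assumes \<beta>: "prob_fun n \<beta>" and ent: "relent n \<beta> \<le> \<epsilon> ^ 4 / 128 * n"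
    and n: "n > 0" and \<epsilon>: "\<epsilon> > 0"
    and F: "\<And>y y'. y \<in> cube n \<Longrightarrow> y' \<in> cube n \<Longrightarrow> F y - F y' \<le> \<epsilon> + 8 / (\<epsilon> * n) * sqdist n y y'"
  shows "(\<Sum>y\<in>cube n. F y) / 2 ^ n - 3 * \<epsilon> \<le> (\<Sum>y\<in>cube n. \<beta> y * F y)"
proof -
  define k where "k = 8 / (\<epsilon> * n)"
  define G where "G y = Min ((\<lambda>y'. F y' + k * sqdist n y y') ` cube n)" for y
  have k: "k \<ge> 0" using n \<epsilon> by (simp add: k_def)
  have G_le: "G y \<le> F y' + k * sqdist n y y'" if "y' \<in> cube n" for y y'
    unfolding G_def using that by (intro Min_le) auto
  have G_att: "\<exists>y'\<in>cube n. G y = F y' + k * sqdist n y y'" for y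
  proof -
    have "G y \<in> (\<lambda>y'. F y' + k * sqdist n y y') ` cube n"
      unfolding G_def using cube_nonempty[of n] by (intro Min_in) auto
    then show ?thesis by blast
  qed
  have GF: "G y \<le> F y" if "y \<in> cube n" for y
    using G_le[OF that, of y] by (simp add: sqdist_def)
  have FG: "F y \<le> G y + \<epsilon>" if y: "y \<in> cube n" for y
  proof -
    obtain y' where "y' \<in> cube n" "G y = F y' + k * sqdist n y y'"
      using G_att by blast
    then show ?thesis using F[OF y, of y'] by (simp add: k_def)
  qed
  define c where "c = k * 4"
  have lip: "G (y[i := a]) \<le> G (y[i := b]) + c"
    if "y \<in> cube n" "i < n" "a = 1 \<or> a = -1" for y i a b
  proof -
    obtain y' where y': "y' \<in> cube n" "G (y[i := b]) = F y' + k * sqdist n (y[i := b]) y'"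
      using G_att by blast
    have "G (y[i := a]) \<le> F y' + k * sqdist n (y[i := a]) y'"
      using G_le y' by blast
    also have "\<dots> \<le> F y' + k * (sqdist n (y[i := b]) y' + 4)"
      using k sqdist_update_le[of y n y' i a b] that y' by (intro add_left_mono mult_left_mono) auto
    finally show ?thesis using y' by (simp add: c_def algebra_simps)
  qed
  have lip': "\<bar>G (y[i := 1]) - G (y[i := -1])\<bar> \<le> c" if "y \<in> cube n" "i < n" for y i
    using lip[OF that, of 1 "-1"] lip[OF that, of "-1" 1] by (simp add: abs_le_iff algebra_simps)
  \<comment> \<open>With c = 32 / (\<epsilon> * n), this value of \<open>l\<close> makes both the
    entropy term and the bounded-differences term equal to \<open>l * \<epsilon>\<close>. Each costs
    one \<epsilon> after division by \<open>l\<close>; passing from \<open>F\<close> to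
    \<open>G\<close> costs the third.\<close>
  define l where "l = \<epsilon> ^ 3 / 128 * n"
  have l: "l > 0" using \<epsilon> n by (simp add: l_def)
  define A where "A = (\<Sum>y\<in>cube n. G y) / 2 ^ n"
  define E where "E = (\<Sum>y\<in>cube n. \<beta> y * G y)"
  have "(\<Sum>y\<in>cube n. exp (- l * G y)) / 2 ^ n \<le> exp (- l * A + n * (l\<^sup>2 * c\<^sup>2 / 8))"
    using bounded_differences_mgf[OF lip', where l = "- l"] by (simp add: A_def field_simps)
  moreover have "(\<Sum>y\<in>cube n. exp (- l * G y)) / 2 ^ n > 0"
    using cube_nonempty by (intro divide_pos_pos sum_pos) auto
  ultimately have "ln ((\<Sum>y\<in>cube n. exp (- l * G y)) / 2 ^ n) \<le> - l * A + n * (l\<^sup>2 * c\<^sup>2 / 8)"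
    using ln_mono ln_exp by metis
  moreover have "(\<Sum>y\<in>cube n. \<beta> y * (- l * G y)) = - l * E"
    by (simp add: E_def sum_distrib_left mult_ac sum_negf)
  ultimately have "- l * E \<le> \<epsilon> ^ 4 / 128 * n + (- l * A + n * (l\<^sup>2 * c\<^sup>2 / 8))"
    using relent_donsker_varadhan[OF \<beta>, of "\<lambda>y. - l * G y"] ent by linarith
  also have "\<epsilon> ^ 4 / 128 * n = l * \<epsilon>"
    by (simp add: l_def power4_eq_xxxx power3_eq_cube)
  also have "n * (l\<^sup>2 * c\<^sup>2 / 8) = l * \<epsilon>"
    using n \<epsilon> by (simp add: l_def c_def k_def power2_eq_square power3_eq_cube field_simps)
  finally have "l * (A - 2 * \<epsilon>) \<le> l * E"
    by (simp add: algebra_simps)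
  then have "A - 2 * \<epsilon> \<le> E" using l by simp
  moreover have "E \<le> (\<Sum>y\<in>cube n. \<beta> y * F y)"
    unfolding E_def using \<beta> GF by (intro sum_mono mult_left_mono) (auto simp: prob_fun_def)
  moreover have "(\<Sum>y\<in>cube n. F y) \<le> (\<Sum>y\<in>cube n. G y + \<epsilon>)"
    by (intro sum_mono FG)
  then have "(\<Sum>y\<in>cube n. F y) / 2 ^ n \<le> A + \<epsilon>"
    by (simp add: A_def sum.distrib card_cube field_simps)
  ultimately show ?thesis by linarith
qed

lemma dot_diff: "dot n x y - dot n x' y = (\<Sum>i<n. (real_of_int (x ! i) - real_of_int (x' ! i)) * real_of_int (y ! i))"
  by (simp add: dot_def sum_subtractf[symmetric] algebra_simps)

lemma abs_dot_le:
  assumes "x \<in> cube n" "y \<in> cube n"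
  shows "\<bar>dot n x y\<bar> \<le> n"
proof -
  have "\<bar>dot n x y\<bar> \<le> (\<Sum>i<n. \<bar>real_of_int (x ! i) * real_of_int (y ! i)\<bar>)"
    unfolding dot_def by (rule sum_abs)
  also have "\<dots> \<le> (\<Sum>i<n. 1)"
  proof (intro sum_mono)
    fix i assume "i \<in> {..<n}"
    then show "\<bar>real_of_int (x ! i) * real_of_int (y ! i)\<bar> \<le> 1"
      using cube_nth[OF assms(1), of i] cube_nth[OF assms(2), of i] by auto
  qed
  finally show ?thesis by simp
qed

text \<open>The vector v = (x - x') / 2 has entries 0, 1, -1 and squared norm \<eta> * n with \<eta>
  \<ge> 3/10, by the bound on the correlation. \<open>rademacher_lower_tail\<close> applies to
  it.\<close>

lemma decorrelated_difference_tail: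
  fixes B :: real
  assumes x: "x \<in> cube n" "x' \<in> cube n" and corr: "dot n x x' \<le> 2 / 5 * n"
    and B: "B \<ge> 0" and n: "n > 0" "(10 / 3 * (B + 5 / 2)) ^ 4 \<le> n"
  shows "1 / 4 * exp (- (5 / 3 * (B + 5 / 2)\<^sup>2) - 20 / 3 * (B + 5 / 2)) * 2 ^ n
    \<le> card {y\<in>cube n. dot n x y - dot n x' y \<ge> (2 * B + 1) * sqrt n}"
proof -
  define v where "v i = (real_of_int (x ! i) - real_of_int (x' ! i)) / 2" for i
  define \<eta> where "\<eta> = (1 - dot n x x' / n) / 2"
  define c where "c = B + 5 / 2"
  \<comment> \<open>Chosen so that \<eta> * s - 2 = B + 1/2, which is half the threshold 2 * B + 1
    because \<open>v\<close> is half the difference.\<close>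
  define s where "s = c / \<eta>"
  have v1: "\<bar>v i\<bar> \<le> 1" if "i < n" for i
    using cube_nth[OF x(1) that] cube_nth[OF x(2) that] by (auto simp: v_def)
  have "(\<Sum>i<n. (v i)\<^sup>2) = (\<Sum>i<n. (1 - real_of_int (x ! i) * real_of_int (x' ! i)) / 2)"
  proof (intro sum.cong refl)
    fix i assume "i \<in> {..<n}"
    then show "(v i)\<^sup>2 = (1 - real_of_int (x ! i) * real_of_int (x' ! i)) / 2"
      using cube_nth[OF x(1), of i] cube_nth[OF x(2), of i] by (auto simp: v_def)
  qed
  also have "\<dots> = \<eta> * n"
    using n by (simp add: \<eta>_def dot_def sum_divide_distrib[symmetric] sum_subtractf field_simps)
  finally have v2: "(\<Sum>i<n. (v i)\<^sup>2) = \<eta> * n" .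
  have "dot n x x' / n \<le> 2 / 5"
    using corr n by (simp add: field_simps)
  then have \<eta>: "\<eta> \<ge> 3 / 10"
    by (simp add: \<eta>_def)
  have c: "c > 0" using B by (simp add: c_def)
  have s0: "s \<ge> 0" using \<eta> c by (simp add: s_def)
  have s_le: "s \<le> 10 / 3 * c"
    using \<eta> c by (simp add: s_def field_simps)
  then have "s ^ 4 \<le> (10 / 3 * c) ^ 4"
    using s0 by (intro power_mono) auto
  then have s4: "s ^ 4 \<le> n" using n(2) by (simp add: c_def)
  have \<eta>s: "\<eta> * s = c" using \<eta> by (simp add: s_def)
  have "\<eta> * s\<^sup>2 / 2 = c * s / 2"
    using \<eta>s by (simp add: power2_eq_square mult.assoc[symmetric])
  also have "\<dots> \<le> c * (10 / 3 * c) / 2"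
    using c s_le by (intro divide_right_mono mult_left_mono) auto
  finally have e: "\<eta> * s\<^sup>2 / 2 \<le> 5 / 3 * c\<^sup>2"
    by (simp add: power2_eq_square)
  have "1 / 4 * exp (- (5 / 3 * c\<^sup>2) - 20 / 3 * c) * 2 ^ n \<le> 1 / 4 * exp (- (\<eta> * s\<^sup>2 / 2) - 2 * s) * 2 ^ n"
    using e s_le by (intro mult_right_mono mult_left_mono) auto
  also have "\<dots> \<le> card {y\<in>cube n. (\<Sum>i<n. v i * real_of_int (y ! i)) \<ge> (\<eta> * s - 2) * sqrt n}"
    by (rule rademacher_lower_tail[OF v1 n(1) s0 s4 v2])
  also have "{y\<in>cube n. (\<Sum>i<n. v i * real_of_int (y ! i)) \<ge> (\<eta> * s - 2) * sqrt n}
      = {y\<in>cube n. dot n x y - dot n x' y \<ge> (2 * B + 1) * sqrt n}"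
  proof -
    have "(\<Sum>i<n. v i * real_of_int (y ! i)) = (dot n x y - dot n x' y) / 2" for y
      by (simp add: dot_diff v_def sum_divide_distrib)
    then have "(\<eta> * s - 2) * sqrt n \<le> (\<Sum>i<n. v i * real_of_int (y ! i))
        \<longleftrightarrow> (2 * B + 1) * sqrt n \<le> dot n x y - dot n x' y" for y
      by (simp only: \<eta>s c_def, intro iffI) (simp_all add: field_simps)
    then show ?thesis by simp
  qed
  finally show ?thesis by (simp add: c_def)
qed

text \<open>A lower bound for the probability that, for the coupled pair and uniform \<open>y\<close>, the correlation is
  at most \<open>0.4 n\<close> (\<open>1 / 14\<close>) and \<open>\<langle>x - x', y\<rangle> \<ge> (2 B + 1) \<surd>n\<close>.\<close>

definition tau :: "real \<Rightarrow> real" where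
  "tau B = 1 / 56 * exp (- (5 / 3 * (B + 5 / 2)\<^sup>2) - 20 / 3 * (B + 5 / 2))"

lemma tau_pos: "tau B > 0"
  by (simp add: tau_def)

lemma tau_le:
  assumes "B \<ge> 0"
  shows "tau B \<le> 1 / 56"
proof -
  have "- (5 / 3 * c\<^sup>2) - 20 / 3 * c \<le> 0" if "c \<ge> 0" for c :: real
    using that zero_le_power2[of c] by linarith
  from this[of "B + 5 / 2"] have "exp (- (5 / 3 * (B + 5 / 2)\<^sup>2) - 20 / 3 * (B + 5 / 2)) \<le> 1"
    using assms by simp
  then show ?thesis
    unfolding tau_def by linarith
qed

text \<open>\<open>F y\<close> is a smoothed probability, over the coupled pair, that the two inner
  products with \<open>y\<close> differ by more than \<open>2 * B * sqrt n\<close>. Its mean over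
  uniform \<open>y\<close> is at least \<open>tau B\<close>; passing to \<beta> loses 3/8 of that,
  and the union bound over \<open>x\<close> and \<open>x'\<close> halves the remaining 5/8.\<close>

lemma product_large_inner_product:
  fixes B :: real
  assumes \<alpha>: "prob_fun n \<alpha>" "relent n \<alpha> \<le> n / 200"
    and \<beta>: "prob_fun n \<beta>" "relent n \<beta> \<le> (tau B / 8) ^ 4 / 128 * n"
    and B: "B \<ge> 0" and n: "n > 0" "(10 / 3 * (B + 5 / 2)) ^ 4 \<le> n"
  shows "5 / 16 * tau B \<le> (\<Sum>x\<in>cube n. \<Sum>y\<in>cube n. \<alpha> x * \<beta> y * (if \<bar>dot n x y\<bar> > B * sqrt n then 1 else 0))"
proof -
  obtain Q :: "int list \<Rightarrow> int list \<Rightarrow> real" where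
    Qnn: "\<And>x x'. x \<in> cube n \<Longrightarrow> x' \<in> cube n \<Longrightarrow> Q x x' \<ge> 0" and
    Q2: "\<And>x. x \<in> cube n \<Longrightarrow> (\<Sum>x'\<in>cube n. Q x x') = \<alpha> x" and
    Q3: "\<And>x'. x' \<in> cube n \<Longrightarrow> (\<Sum>x\<in>cube n. Q x x') = \<alpha> x'" and
    Qmom: "\<And>u :: nat \<Rightarrow> real. (\<Sum>x\<in>cube n. \<Sum>x'\<in>cube n. Q x x' *
        (\<Sum>i<n. u i * (real_of_int (x ! i) - real_of_int (x' ! i)))\<^sup>2) \<le> 32 * (\<Sum>i<n. (u i)\<^sup>2)" and
    Qcorr: "(\<Sum>x\<in>cube n. \<Sum>x'\<in>cube n. Q x x' * dot n x x') \<le> 3 / 10 * n"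
    by (rule decorrelated_coupling[OF \<alpha>]) (rule that)
  define r where "r = sqrt n"
  have r: "r > 0" "r\<^sup>2 = n" using n by (auto simp: r_def)
  have Qtot: "(\<Sum>x\<in>cube n. \<Sum>x'\<in>cube n. Q x x') = 1"
    using \<alpha>(1) by (simp add: Q2 prob_fun_def)
  define \<epsilon> where "\<epsilon> = tau B / 8"
  have \<epsilon>: "\<epsilon> > 0" by (simp add: \<epsilon>_def tau_pos)
  \<comment> \<open>A 1-Lipschitz cutoff: 0 up to \<open>2 * B\<close> and 1 from
    \<open>2 * B + 1\<close> on. The unit ramp explains the \<open>+ 1\<close> in the tail bound for
    the difference.\<close>
  define \<phi> where "\<phi> m = max 0 (min 1 (\<bar>m\<bar> - 2 * B))" for m :: real
  define F where "F y = (\<Sum>x\<in>cube n. \<Sum>x'\<in>cube n. Q x x' * \<phi> ((dot n x y - dot n x' y) / r))" for y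
  let ?bad = "\<lambda>x y. if \<bar>dot n x y\<bar> > B * r then 1 else 0 :: real"

  have lip: "F y - F y' \<le> \<epsilon> + 8 / (\<epsilon> * n) * sqdist n y y'" for y y'
  proof -
    define u where "u i = real_of_int (y ! i) - real_of_int (y' ! i)" for i
    define a where "a x x' = (\<Sum>i<n. u i * (real_of_int (x ! i) - real_of_int (x' ! i)))" for x x'
    have "\<phi> ((dot n x y - dot n x' y) / r) - \<phi> ((dot n x y' - dot n x' y') / r)
        \<le> \<epsilon> + (a x x')\<^sup>2 / (4 * \<epsilon> * n)" for x x'
    proof -
      have a: "(dot n x y - dot n x' y) - (dot n x y' - dot n x' y') = a x x'"
        unfolding dot_diff sum_subtractf[symmetric] a_def u_def by (intro sum.cong refl) (simp add: algebra_simps)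
      have "\<phi> m - \<phi> m' \<le> \<bar>m - m'\<bar>" for m m'
        using abs_triangle_ineq2[of m m'] unfolding \<phi>_def by (auto simp: max_def min_def)
      then have "\<phi> ((dot n x y - dot n x' y) / r) - \<phi> ((dot n x y' - dot n x' y') / r)
          \<le> \<bar>(dot n x y - dot n x' y) / r - (dot n x y' - dot n x' y') / r\<bar>" by blast
      also have "\<dots> = \<bar>a x x' / r\<bar>"
        by (simp add: a[symmetric] diff_divide_distrib)
      \<comment> \<open>The AM-GM inequality trades the absolute value for a square, to which the
        second moment bound \<open>Qmom\<close> applies.\<close>
      also have "\<dots> \<le> \<epsilon> + \<bar>a x x' / r\<bar>\<^sup>2 / (4 * \<epsilon>)"
      proof -
        have "m \<le> \<epsilon> + m\<^sup>2 / (4 * \<epsilon>)" for m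
          using zero_le_power2[of "2 * \<epsilon> - m"] \<epsilon> by (simp add: power2_eq_square field_simps)
        then show ?thesis .
      qed
      also have "\<bar>a x x' / r\<bar>\<^sup>2 = (a x x')\<^sup>2 / n"
        by (simp add: power_divide r)
      finally show ?thesis by (simp add: mult_ac)
    qed
    then have "F y - F y' \<le> (\<Sum>x\<in>cube n. \<Sum>x'\<in>cube n. Q x x' * (\<epsilon> + (a x x')\<^sup>2 / (4 * \<epsilon> * n)))"
      unfolding F_def sum_subtractf[symmetric] right_diff_distrib[symmetric]
      by (intro sum_mono mult_left_mono Qnn)
    also have "\<dots> = \<epsilon> * (\<Sum>x\<in>cube n. \<Sum>x'\<in>cube n. Q x x')
        + (\<Sum>x\<in>cube n. \<Sum>x'\<in>cube n. Q x x' * (a x x')\<^sup>2) / (4 * \<epsilon> * n)"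
      by (simp add: distrib_left sum.distrib sum_distrib_left sum_divide_distrib mult_ac)
    also have "\<dots> \<le> \<epsilon> + 32 * (\<Sum>i<n. (u i)\<^sup>2) / (4 * \<epsilon> * n)"
      unfolding Qtot a_def using \<epsilon> by (intro add_mono divide_right_mono Qmom) auto
    finally show ?thesis
      by (simp add: u_def sqdist_def)
  qed

  \<comment> \<open>A nonzero value of the cutoff forces one of the two inner products to exceed
    \<open>B * r\<close>, and \<open>x\<close> and \<open>x'\<close> both have law \<alpha>.\<close>
  have bound: "F y \<le> 2 * (\<Sum>x\<in>cube n. \<alpha> x * ?bad x y)" for y
  proof -
    have "\<phi> ((dot n x y - dot n x' y) / r) \<le> ?bad x y + ?bad x' y" for x x'
    proof (cases "\<bar>dot n x y\<bar> > B * r \<or> \<bar>dot n x' y\<bar> > B * r")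
      case True
      then show ?thesis by (auto simp: \<phi>_def)
    next
      case False
      then have "\<bar>dot n x y - dot n x' y\<bar> \<le> 2 * B * r" by linarith
      then have "\<bar>(dot n x y - dot n x' y) / r\<bar> \<le> 2 * B"
        using r by (simp add: field_simps)
      then show ?thesis by (simp add: \<phi>_def)
    qed
    then have "F y \<le> (\<Sum>x\<in>cube n. \<Sum>x'\<in>cube n. Q x x' * (?bad x y + ?bad x' y))"
      unfolding F_def by (intro sum_mono mult_left_mono Qnn)
    also have "\<dots> = (\<Sum>x\<in>cube n. \<Sum>x'\<in>cube n. Q x x' * ?bad x y) + (\<Sum>x\<in>cube n. \<Sum>x'\<in>cube n. Q x x' * ?bad x' y)"
      unfolding distrib_left sum.distrib ..
    also have "(\<Sum>x\<in>cube n. \<Sum>x'\<in>cube n. Q x x' * ?bad x' y) = (\<Sum>x'\<in>cube n. \<Sum>x\<in>cube n. Q x x' * ?bad x' y)"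
      by (rule sum.swap)
    finally show ?thesis
      unfolding sum_distrib_right[symmetric] using Q2 Q3 by simp
  qed

  define p where "p = (\<Sum>x\<in>cube n. \<Sum>x'\<in>cube n. Q x x' * (if dot n x x' \<le> 2 / 5 * n then 1 else 0))"
  \<comment> \<open>Reverse Markov inequality: inner products are at least -n, so a mean of at most
    0.3 n leaves probability at least 0.1 / 1.4 = 1/14 for values up to 0.4 n.\<close>
  have "(\<Sum>x\<in>cube n. \<Sum>x'\<in>cube n. Q x x' * (2 / 5 * n - 7 / 5 * n * (if dot n x x' \<le> 2 / 5 * n then 1 else 0)))
      \<le> (\<Sum>x\<in>cube n. \<Sum>x'\<in>cube n. Q x x' * dot n x x')"
  proof (intro sum_mono mult_left_mono Qnn)
    fix x x' assume "x \<in> cube n" "x' \<in> cube n"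
    then show "2 / 5 * n - 7 / 5 * n * (if dot n x x' \<le> 2 / 5 * n then 1 else 0) \<le> dot n x x'"
      using abs_dot_le[of x n x'] by auto
  qed
  moreover have "(\<Sum>x\<in>cube n. \<Sum>x'\<in>cube n. Q x x' * (2 / 5 * n - 7 / 5 * n * (if dot n x x' \<le> 2 / 5 * n then 1 else 0)))
      = 2 / 5 * n * (\<Sum>x\<in>cube n. \<Sum>x'\<in>cube n. Q x x') - 7 / 5 * n * p"
    unfolding p_def right_diff_distrib sum_subtractf sum_distrib_left by (simp only: mult_ac)
  ultimately have "2 / 5 * n - 7 / 5 * n * p \<le> 3 / 10 * n"
    using Qcorr unfolding Qtot by linarith
  then have "n * (1 / 14) \<le> n * p" by (simp add: mult_ac)
  then have p: "p \<ge> 1 / 14" using n by simp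

  define w where "w = 1 / 4 * exp (- (5 / 3 * (B + 5 / 2)\<^sup>2) - 20 / 3 * (B + 5 / 2))"
  have avg_\<phi>: "(if dot n x x' \<le> 2 / 5 * n then 1 else 0) * (w * 2 ^ n) \<le> (\<Sum>y\<in>cube n. \<phi> ((dot n x y - dot n x' y) / r))"
    if "x \<in> cube n" "x' \<in> cube n" for x x'
  proof (cases "dot n x x' \<le> 2 / 5 * n")
    case True
    have "w * 2 ^ n \<le> card {y\<in>cube n. dot n x y - dot n x' y \<ge> (2 * B + 1) * r}"
      unfolding w_def r_def by (rule decorrelated_difference_tail[OF that True B n])
    also have "\<dots> = (\<Sum>y\<in>cube n. if dot n x y - dot n x' y \<ge> (2 * B + 1) * r then 1 else 0)"
      by (simp add: sum.If_cases Int_def)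
    also have "\<dots> \<le> (\<Sum>y\<in>cube n. \<phi> ((dot n x y - dot n x' y) / r))"
    proof (intro sum_mono)
      fix y
      show "(if dot n x y - dot n x' y \<ge> (2 * B + 1) * r then 1 else 0) \<le> \<phi> ((dot n x y - dot n x' y) / r)"
      proof (cases "dot n x y - dot n x' y \<ge> (2 * B + 1) * r")
        case True
        then have "(dot n x y - dot n x' y) / r \<ge> 2 * B + 1"
          using r by (simp add: field_simps)
        then have "\<phi> ((dot n x y - dot n x' y) / r) = 1"
          unfolding \<phi>_def by linarith
        then show ?thesis by simp
      qed (simp add: \<phi>_def)
    qed
    finally show ?thesis using True by simp
  next
    case False
    then show ?thesis by (auto simp: \<phi>_def intro: sum_nonneg)
  qed
  have "1 / 14 * (w * 2 ^ n) \<le> p * (w * 2 ^ n)"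
    using p by (intro mult_right_mono) (auto simp: w_def)
  also have "\<dots> = (\<Sum>x\<in>cube n. \<Sum>x'\<in>cube n. Q x x' * ((if dot n x x' \<le> 2 / 5 * n then 1 else 0) * (w * 2 ^ n)))"
    by (simp only: p_def sum_distrib_right mult.assoc)
  also have "\<dots> \<le> (\<Sum>x\<in>cube n. \<Sum>x'\<in>cube n. Q x x' * (\<Sum>y\<in>cube n. \<phi> ((dot n x y - dot n x' y) / r)))"
    by (intro sum_mono mult_left_mono Qnn avg_\<phi>)
  also have "\<dots> = (\<Sum>x\<in>cube n. \<Sum>y\<in>cube n. \<Sum>x'\<in>cube n. Q x x' * \<phi> ((dot n x y - dot n x' y) / r))"
    unfolding sum_distrib_left by (intro sum.cong refl sum.swap)
  also have "\<dots> = (\<Sum>y\<in>cube n. F y)"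
    unfolding F_def by (rule sum.swap)
  finally have avg: "tau B \<le> (\<Sum>y\<in>cube n. F y) / 2 ^ n"
    by (simp add: tau_def w_def field_simps)

  have "tau B - 3 * \<epsilon> \<le> (\<Sum>y\<in>cube n. \<beta> y * F y)"
    using relent_expectation_ge[of n \<beta> \<epsilon> F, OF \<beta>(1) _ n(1) \<epsilon> lip] \<beta>(2) avg
    by (simp add: \<epsilon>_def)
  also have "\<dots> \<le> (\<Sum>y\<in>cube n. \<beta> y * (2 * (\<Sum>x\<in>cube n. \<alpha> x * ?bad x y)))"
    using \<beta>(1) by (intro sum_mono mult_left_mono bound) (auto simp: prob_fun_def)
  also have "\<dots> = 2 * (\<Sum>y\<in>cube n. \<Sum>x\<in>cube n. \<alpha> x * \<beta> y * ?bad x y)"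
    unfolding sum_distrib_left by (intro sum.cong refl) (simp only: mult_ac)
  also have "(\<Sum>y\<in>cube n. \<Sum>x\<in>cube n. \<alpha> x * \<beta> y * ?bad x y) = (\<Sum>x\<in>cube n. \<Sum>y\<in>cube n. \<alpha> x * \<beta> y * ?bad x y)"
    by (rule sum.swap)
  finally have "5 / 16 * tau B \<le> (\<Sum>x\<in>cube n. \<Sum>y\<in>cube n. \<alpha> x * \<beta> y * ?bad x y)"
    by (simp add: \<epsilon>_def)
  then show ?thesis
    unfolding r_def .
qed

section \<open>Tail estimates and anticoncentration\<close>

lemma tail_nonneg: "tail x \<ge> 0"
  unfolding tail_def set_lebesgue_integral_def by (intro mult_nonneg_nonneg integral_nonneg_AE) auto

text \<open>For s \<ge> x \<ge> 0 the Gaussian density at \<open>s\<close> is at most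
  \<open>exp (- x\<^sup>2 / 2)\<close> times the density of mean \<open>x\<close>, whose integral is
  1.\<close>

lemma tail_le_exp:
  assumes "x \<ge> 0"
  shows "tail x \<le> exp (- x\<^sup>2 / 2)"
proof -
  have "tail x = (LBINT s. indicator {x..} s * normal_density 0 1 s)"
    unfolding tail_def set_lebesgue_integral_def normal_density_def
    by (subst integral_mult_right_zero[symmetric]) (auto simp: mult_ac)
  also have "\<dots> \<le> (LBINT s. exp (- x\<^sup>2 / 2) * normal_density x 1 s)"
  proof (intro integral_mono)
    show "integrable lborel (\<lambda>s. indicator {x..} s * normal_density 0 1 s)"
      using integrable_mult_indicator[of "{x..}" lborel "normal_density 0 1"] by simp
    show "indicator {x..} s * normal_density 0 1 s \<le> exp (- x\<^sup>2 / 2) * normal_density x 1 s" for s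
    proof (cases "s \<ge> x")
      case True
      then have "0 \<le> x * (s - x)" using assms by simp
      then have "- s\<^sup>2 / 2 \<le> - x\<^sup>2 / 2 + - (s - x)\<^sup>2 / 2"
        by (simp add: power2_eq_square field_simps)
      then have "exp (- s\<^sup>2 / 2) \<le> exp (- x\<^sup>2 / 2) * exp (- (s - x)\<^sup>2 / 2)"
        unfolding exp_add[symmetric] by (simp only: exp_le_cancel_iff)
      then show ?thesis
        using True by (simp add: normal_density_def divide_right_mono)
    qed simp
  qed simp
  also have "\<dots> = exp (- x\<^sup>2 / 2)" by simp
  finally show ?thesis .
qed

text \<open>The exponent of the tail has quadratic coefficient 2.02005, that of \<open>tau B\<close>
  only 5/3. From \<open>B\<close> = 66 on, the surplus pays for the linear and constant terms and
  for a further factor \<open>exp (- 8)\<close>, which covers the constant 5/16 * 1/56.\<close>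

lemma tail_less_tau:
  assumes "B \<ge> 66"
  shows "tail (2.01 * B) < 5 / 16 * tau B"
proof -
  define c where "c = B + 5 / 2"
  have e2: "5 \<le> exp (2 :: real)"
    using exp_lower_Taylor_quadratic[of "2 :: real"] by simp
  have "(5 :: real) ^ 4 \<le> exp 2 ^ 4"
    using e2 by (intro power_mono) auto
  then have e8: "625 \<le> exp (8 :: real)"
    by (simp add: exp_of_nat_mult[symmetric])
  have "66 * B \<le> B * B"
    using assms by (intro mult_right_mono) auto
  moreover have "(2.01 * B)\<^sup>2 / 2 = 202005 / 100000 * (B * B)" "c\<^sup>2 = B * B + 5 * B + 25 / 4"
    by (simp_all add: c_def power2_eq_square field_simps)
  ultimately have "- (2.01 * B)\<^sup>2 / 2 < (- (5 / 3 * c\<^sup>2) - 20 / 3 * c) + - 8"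
    using assms c_def by linarith
  then have "exp (- (2.01 * B)\<^sup>2 / 2) < exp (- (5 / 3 * c\<^sup>2) - 20 / 3 * c) * exp (- 8)"
    unfolding exp_add[symmetric] by (simp only: exp_less_cancel_iff)
  also have "\<dots> \<le> exp (- (5 / 3 * c\<^sup>2) - 20 / 3 * c) * (5 / 16 * (1 / 56))"
    using e8 by (intro mult_left_mono) (auto simp: exp_minus field_simps)
  also have "\<dots> = 5 / 16 * tau B"
    by (simp add: tau_def c_def)
  finally show ?thesis
    using tail_le_exp[of "2.01 * B"] assms by simp
qed

section \<open>Anticoncentration of sums of signs\<close>

lemma sum_cube_sum_list_append:
  fixes f :: "int \<Rightarrow> real"
  shows "(\<Sum>x\<in>cube (m + k). f (sum_list x)) = (\<Sum>x\<in>cube m. \<Sum>x'\<in>cube k. f (sum_list x + sum_list x'))"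
proof (induction m arbitrary: f)
  case (Suc m)
  show ?case
    using Suc.IH[of "\<lambda>a. f (1 + a)"] Suc.IH[of "\<lambda>a. f (-1 + a)"]
    by (simp add: sum_cube_Suc sum.distrib algebra_simps)
qed simp

lemma sum_cube_sum_list_uminus:
  fixes f :: "int \<Rightarrow> real"
  shows "(\<Sum>x\<in>cube m. f (sum_list x)) = (\<Sum>x\<in>cube m. f (- sum_list x))"
proof (induction m arbitrary: f)
  case (Suc m)
  show ?case
    using Suc.IH[of "\<lambda>a. f (1 + a)"] Suc.IH[of "\<lambda>a. f (-1 + a)"]
    by (simp add: sum_cube_Suc sum.distrib)
qed simp

text \<open>Coordinatewise multiplication by \<open>y\<close> permutes the cube, so the inner
  product with a fixed \<open>y\<close> is distributed as a sum of signs.\<close>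

lemma sum_cube_dot:
  fixes f :: "real \<Rightarrow> real"
  assumes "y \<in> cube n"
  shows "(\<Sum>x\<in>cube n. f (dot n x y)) = (\<Sum>x\<in>cube n. f (sum_list x))"
  using assms
proof (induction n arbitrary: f y)
  case (Suc n)
  from Suc.prems obtain a y' where y: "y = a # y'" "y' \<in> cube n" "a = 1 \<or> a = -1"
    by (auto simp: cube_Suc)
  have "dot (Suc n) (c # x) y = real_of_int c * real_of_int a + dot n x y'" for c x
    unfolding dot_def y sum.lessThan_Suc_shift by simp
  then show ?case
    using y(3) Suc.IH[OF y(2), of "\<lambda>t. f (1 + t)"] Suc.IH[OF y(2), of "\<lambda>t. f (-1 + t)"]
    by (auto simp: sum_cube_Suc sum.distrib algebra_simps)
qed (simp add: dot_def)

lemma sum_cube_sum_list_square: "(\<Sum>x\<in>cube m. (real_of_int (sum_list x))\<^sup>2) = m * 2 ^ m"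
proof (induction m)
  case (Suc m)
  have "(\<Sum>x\<in>cube (Suc m). (real_of_int (sum_list x))\<^sup>2) = (\<Sum>x\<in>cube m. 2 * (real_of_int (sum_list x))\<^sup>2 + 2)"
    unfolding sum_cube_Suc by (intro sum.cong refl) (simp add: power2_eq_square algebra_simps)
  also have "\<dots> = 2 * (m * 2 ^ m) + 2 * 2 ^ m"
    by (simp add: sum.distrib sum_distrib_left[symmetric] Suc card_cube)
  finally show ?case by (simp add: algebra_simps)
qed simp

text \<open>Chebyshev's inequality with variance m \<le> n / 2.\<close>

lemma card_sum_list_le:
  assumes "2 * m \<le> n" "n > 0"
  shows "2 ^ m / 2 \<le> real (card {x\<in>cube m. \<bar>real_of_int (sum_list x)\<bar> \<le> sqrt n})"
proof -
  let ?s = "\<lambda>x. real_of_int (sum_list x)"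
  have "(\<Sum>x\<in>cube m. 1 - (?s x)\<^sup>2 / n) \<le> (\<Sum>x\<in>cube m. if \<bar>?s x\<bar> \<le> sqrt n then 1 else 0)"
  proof (intro sum_mono)
    fix x
    show "1 - (?s x)\<^sup>2 / n \<le> (if \<bar>?s x\<bar> \<le> sqrt n then 1 else 0)"
    proof (cases "\<bar>?s x\<bar> \<le> sqrt n")
      case False
      then have "(sqrt n)\<^sup>2 \<le> \<bar>?s x\<bar>\<^sup>2"
        by (intro power_mono) auto
      then show ?thesis using False assms(2) by (simp add: field_simps)
    qed simp
  qed
  also have "\<dots> = real (card {x\<in>cube m. \<bar>?s x\<bar> \<le> sqrt n})"
    by (simp add: sum.If_cases Int_def)
  also have "(\<Sum>x\<in>cube m. 1 - (?s x)\<^sup>2 / n) = 2 ^ m - m * 2 ^ m / n"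
    by (simp add: sum_subtractf card_cube sum_divide_distrib[symmetric] sum_cube_sum_list_square)
  finally have "2 ^ m - m * 2 ^ m / n \<le> real (card {x\<in>cube m. \<bar>?s x\<bar> \<le> sqrt n})" .
  moreover have "m * 2 ^ m / n \<le> (2 ^ m / 2 :: real)"
    using assms by (simp add: field_simps)
  ultimately show ?thesis by linarith
qed

lemma card_pairs_eq_sum:
  assumes "finite A" "finite B"
  shows "real (card {(x, y) \<in> A \<times> B. P x y}) = (\<Sum>x\<in>A. \<Sum>y\<in>B. if P x y then 1 else 0)"
proof -
  have "(\<Sum>x\<in>A. \<Sum>y\<in>B. if P x y then 1 else 0 :: real)
      = (\<Sum>w\<in>A \<times> B. if P (fst w) (snd w) then 1 else 0)"
    by (simp add: sum.cartesian_product case_prod_beta')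
  also have "\<dots> = real (card (A \<times> B \<inter> {w. P (fst w) (snd w)}))"
    using assms by (simp add: sum.If_cases)
  also have "A \<times> B \<inter> {w. P (fst w) (snd w)} = {(x, y) \<in> A \<times> B. P x y}"
    by auto
  finally show ?thesis by simp
qed

text \<open>A sum of signs is split into two independent halves; they fall into the same cell with
  probability at least \<open>p\<^sup>2 / k\<close> if \<open>k\<close> cells carry mass \<open>p\<close>.\<close>

lemma card_same_cell_ge:
  fixes j :: "'a \<Rightarrow> 'b"
  assumes "finite A" "finite J" "j ` A \<subseteq> J"
  shows "(real (card A))\<^sup>2 \<le> card J * real (card {(x, x') \<in> A \<times> A. j x = j x'})"
proof -
  let ?c = "\<lambda>i. real (card {x\<in>A. j x = i})"
  let ?P = "{(x, x') \<in> A \<times> A. j x = j x'}"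
  have 1: "real (card A) = (\<Sum>i\<in>J. ?c i)"
    using sum.group[OF assms, of "\<lambda>_. 1 :: real"] by simp
  have fin: "finite ?P"
    using assms(1) by (auto intro: finite_subset[of _ "A \<times> A"])
  have "real (card ?P) = (\<Sum>i\<in>J. real (card {w \<in> ?P. j (fst w) = i}))"
    using sum.group[OF fin assms(2), of "j \<circ> fst" "\<lambda>_. 1 :: real"] assms(3) by force
  moreover have "{w \<in> ?P. j (fst w) = i} = {x\<in>A. j x = i} \<times> {x\<in>A. j x = i}" for i
    by auto
  ultimately have 2: "real (card ?P) = (\<Sum>i\<in>J. (?c i)\<^sup>2)"
    by (simp add: card_cartesian_product power2_eq_square)
  show ?thesis
    unfolding 1 2 using sum_squared_le_sum_of_squares[of ?c J] assms by (simp add: mult.commute)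
qed

text \<open>At least half of the sums lie in [-sqrt n, sqrt n], which meets 21 cells of width sqrt n
  / 10. Two sums in one cell differ by at most the width, and (1/2) * (1/2) / 21 = 1/84.\<close>

lemma card_sum_list_diff_ge:
  assumes "2 * m \<le> n" "n > 0"
  shows "2 ^ (2 * m) / 84 \<le> real (card {(x, x') \<in> cube m \<times> cube m.
    \<bar>real_of_int (sum_list x - sum_list x')\<bar> \<le> sqrt n / 10})"
proof -
  define w where "w = sqrt n / 10"
  have w: "w > 0" using assms by (simp add: w_def)
  define A where "A = {x\<in>cube m. \<bar>real_of_int (sum_list x)\<bar> \<le> sqrt n}"
  define j where "j x = \<lfloor>real_of_int (sum_list x) / w\<rfloor>" for x
  have fin: "finite A" by (simp add: A_def)
  have "j ` A \<subseteq> {-10..10}"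
  proof safe
    fix x assume "x \<in> A"
    then have "\<bar>real_of_int (sum_list x)\<bar> \<le> 10 * w" by (simp add: A_def w_def)
    then have "- 10 \<le> real_of_int (sum_list x) / w" "real_of_int (sum_list x) / w \<le> 10"
      using w by (auto simp: field_simps abs_le_iff)
    then show "j x \<in> {-10..10}"
      unfolding j_def by (simp add: le_floor_iff floor_le_iff)
  qed
  then have "(real (card A))\<^sup>2 \<le> card {-10..10::int} * real (card {(x, x') \<in> A \<times> A. j x = j x'})"
    by (intro card_same_cell_ge fin) auto
  moreover have "(2 ^ m / 2)\<^sup>2 \<le> (real (card A))\<^sup>2"
    using card_sum_list_le[OF assms] unfolding A_def by (intro power_mono) auto
  moreover have "card {(x, x') \<in> A \<times> A. j x = j x'}
      \<le> card {(x, x') \<in> cube m \<times> cube m. \<bar>real_of_int (sum_list x - sum_list x')\<bar> \<le> w}"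
  proof (intro card_mono)
    show "finite {(x, x') \<in> cube m \<times> cube m. \<bar>real_of_int (sum_list x - sum_list x')\<bar> \<le> w}"
      by (rule finite_subset[of _ "cube m \<times> cube m"]) auto
    have "\<bar>real_of_int (sum_list x - sum_list x')\<bar> \<le> w" if "j x = j x'" for x x'
    proof -
      have "\<bar>real_of_int (sum_list x) / w - real_of_int (sum_list x') / w\<bar> \<le> 1"
        using that unfolding j_def by linarith
      then have "\<bar>real_of_int (sum_list x - sum_list x') / w\<bar> \<le> 1"
        by (simp add: diff_divide_distrib)
      then show ?thesis using w by (simp add: abs_divide field_simps)
    qed
    then show "{(x, x') \<in> A \<times> A. j x = j x'}
        \<subseteq> {(x, x') \<in> cube m \<times> cube m. \<bar>real_of_int (sum_list x - sum_list x')\<bar> \<le> w}"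
      by (auto simp: A_def)
  qed
  moreover have c21: "real (card {-10..10::int}) = 21" by simp
  ultimately have "(2 ^ m / 2)\<^sup>2 \<le> 21 * real (card {(x, x') \<in> cube m \<times> cube m.
      \<bar>real_of_int (sum_list x - sum_list x')\<bar> \<le> w})"
    by (simp only: c21)
  then show ?thesis
    by (simp add: w_def power_divide power_mult[symmetric] mult.commute)
qed

text \<open>The sum of \<open>n\<close> signs splits into two halves of equal length, one of which
  may be negated by symmetry, and one more sign if \<open>n\<close> is odd. For n \<ge> 100 that
  sign is absorbed by enlarging the bound from sqrt n / 10 to sqrt n / 5.\<close>

lemma card_small_inner_product_ge:
  assumes y: "y \<in> cube n" and n: "n \<ge> 100"
  shows "2 ^ n / 84 \<le> real (card {x\<in>cube n. \<bar>dot n x y\<bar> \<le> sqrt n / 5})"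
proof -
  define m where "m = n div 2"
  define e where "e = n mod 2"
  have n_eq: "n = m + (m + e)" and e: "e = 0 \<or> e = 1"
    unfolding m_def e_def by presburger+
  have r: "sqrt n \<ge> 10"
    using n by (intro real_le_rsqrt) simp
  let ?f = "\<lambda>a :: real. if \<bar>a\<bar> \<le> sqrt n / 5 then 1 else 0 :: real"
  have "2 ^ n / 84 = 2 ^ e * (2 ^ (2 * m) / 84 :: real)"
    by (subst n_eq) (simp add: power_add mult_2)
  also have "\<dots> \<le> 2 ^ e * real (card {(x, x') \<in> cube m \<times> cube m. \<bar>real_of_int (sum_list x - sum_list x')\<bar> \<le> sqrt n / 10})"
    using n by (intro mult_left_mono card_sum_list_diff_ge) (auto simp: m_def)
  also have "\<dots> = (\<Sum>x\<in>cube m. \<Sum>x'\<in>cube m. \<Sum>z\<in>cube e.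
      if \<bar>real_of_int (sum_list x - sum_list x')\<bar> \<le> sqrt n / 10 then 1 else 0)"
    unfolding card_pairs_eq_sum[OF finite_cube finite_cube] by (simp add: sum_distrib_left card_cube)
  also have "\<dots> \<le> (\<Sum>x\<in>cube m. \<Sum>x'\<in>cube m. \<Sum>z\<in>cube e. ?f (sum_list x + (- sum_list x' + sum_list z)))"
  proof (intro sum_mono)
    fix x x' z assume "z \<in> cube e"
    then have "\<bar>sum_list z\<bar> \<le> 1" using e by (auto simp: cube_Suc)
    then have z: "\<bar>real_of_int (sum_list z)\<bar> \<le> 1" by linarith
    have "\<bar>real_of_int (sum_list x - sum_list x')\<bar> \<le> sqrt n / 10 \<Longrightarrow>
        \<bar>real_of_int (sum_list x + (- sum_list x' + sum_list z))\<bar> \<le> sqrt n / 5"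
      using z r unfolding of_int_add of_int_minus of_int_diff by linarith
    then show "(if \<bar>real_of_int (sum_list x - sum_list x')\<bar> \<le> sqrt n / 10 then 1 else 0)
        \<le> ?f (sum_list x + (- sum_list x' + sum_list z))"
      by auto
  qed
  also have "\<dots> = (\<Sum>x\<in>cube m. \<Sum>x'\<in>cube m. \<Sum>z\<in>cube e. ?f (sum_list x + (sum_list x' + sum_list z)))"
    by (intro sum.cong refl sum_cube_sum_list_uminus[symmetric,
          of "\<lambda>a. \<Sum>z\<in>cube e. ?f (sum_list x + (a + sum_list z))" for x])
  also have "\<dots> = (\<Sum>x\<in>cube m. \<Sum>x'\<in>cube (m + e). ?f (sum_list x + sum_list x'))"
    by (rule sum.cong[OF refl], rule sum_cube_sum_list_append[symmetric])
  also have "\<dots> = (\<Sum>x\<in>cube n. ?f (sum_list x))"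
    by (subst n_eq, rule sum_cube_sum_list_append[symmetric, of "\<lambda>a. ?f a"])
  also have "\<dots> = (\<Sum>x\<in>cube n. ?f (dot n x y))"
    by (rule sum_cube_dot[OF y, symmetric])
  also have "\<dots> = real (card {x\<in>cube n. \<bar>dot n x y\<bar> \<le> sqrt n / 5})"
    by (simp add: sum.If_cases Int_def)
  finally show ?thesis .
qed

section \<open>The corruption bound\<close>

text \<open>The relative entropy per coordinate that \<open>product_large_inner_product\<close>
  allows for \<beta>; by \<open>delta_le\<close> it also respects the bound 1/200 for
  \<alpha>.\<close>

definition delta :: "real \<Rightarrow> real" where
  "delta B = (tau B / 8) ^ 4 / 128"

lemma delta_pos: "delta B > 0"
  using tau_pos[of B] by (simp add: delta_def)

lemma delta_le:
  assumes "B \<ge> 0"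
  shows "delta B \<le> 1 / 200"
proof -
  have "(tau B / 8) ^ 4 \<le> (1 / 8) ^ 4"
    using tau_pos[of B] tau_le[OF assms] by (intro power_mono) auto
  also have "\<dots> = 1 / 4096"
    by (simp add: power_divide)
  finally show ?thesis by (simp add: delta_def)
qed

lemma ORT_eq: "ORT b n x y = (if \<bar>dot n x y\<bar> \<le> b * sqrt n then 1 else -1)"
  by (simp add: ORT_def dot_def)

lemma product_ORT_error:
  fixes b B :: real
  assumes \<alpha>: "prob_fun n \<alpha>" and \<beta>: "prob_fun n \<beta>" and ent: "relent n \<alpha> + relent n \<beta> \<le> delta B * n"
    and B: "b \<le> B" "B \<ge> 0" and n: "n > 0" "(10 / 3 * (B + 5 / 2)) ^ 4 \<le> n"
  shows "5 / 16 * tau B \<le> (\<Sum>x\<in>cube n. \<Sum>y\<in>cube n. \<alpha> x * \<beta> y * (if ORT b n x y = 1 then 0 else 1))"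
proof -
  have "relent n \<alpha> \<le> delta B * n"
    using relent_nonneg[OF \<beta>] ent by linarith
  also have "\<dots> \<le> n / 200"
    using mult_right_mono[OF delta_le[OF B(2)], of "real n"] by simp
  finally have 1: "relent n \<alpha> \<le> n / 200" .
  have 2: "relent n \<beta> \<le> (tau B / 8) ^ 4 / 128 * n"
    using relent_nonneg[OF \<alpha>] ent by (simp add: delta_def)
  have "5 / 16 * tau B \<le> (\<Sum>x\<in>cube n. \<Sum>y\<in>cube n. \<alpha> x * \<beta> y * (if \<bar>dot n x y\<bar> > B * sqrt n then 1 else 0))"
    by (rule product_large_inner_product[OF \<alpha> 1 \<beta> 2 B(2) n])
  also have "\<dots> \<le> (\<Sum>x\<in>cube n. \<Sum>y\<in>cube n. \<alpha> x * \<beta> y * (if ORT b n x y = 1 then 0 else 1))"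
  proof (intro sum_mono mult_left_mono)
    fix x y assume "x \<in> cube n" "y \<in> cube n"
    then show "0 \<le> \<alpha> x * \<beta> y" using \<alpha> \<beta> by (simp add: prob_fun_def)
    have "b * sqrt n \<le> B * sqrt n" using B by (intro mult_right_mono) auto
    then show "(if \<bar>dot n x y\<bar> > B * sqrt n then 1 else 0) \<le> (if ORT b n x y = 1 then 0 else 1 :: real)"
      by (auto simp: ORT_eq)
  qed
  finally show ?thesis .
qed

lemma prob_unif: "measure_pmf.prob (unif n) S = card ((cube n \<times> cube n) \<inter> S) / 4 ^ n"
proof -
  have "measure_pmf.prob (unif n) S = card ((cube n \<times> cube n) \<inter> S) / card (cube n \<times> cube n)"
    unfolding unif_def using cube_nonempty[of n] by (intro measure_pmf_of_set) auto
  then show ?thesis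
    by (simp add: card_cartesian_product card_cube power_mult_distrib[symmetric])
qed

lemma uniform_on_subset:
  assumes "A \<subseteq> cube n" "A \<noteq> {}"
  shows "prob_fun n (\<lambda>x. if x \<in> A then 1 / card A else 0)"
    and "relent n (\<lambda>x. if x \<in> A then 1 / card A else 0) = - ln (card A / 2 ^ n)"
proof -
  have fin: "finite A" using assms finite_subset by blast
  then have c: "card A > 0" using assms by (simp add: card_gt_0_iff)
  have i: "cube n \<inter> A = A" using assms by blast
  show "prob_fun n (\<lambda>x. if x \<in> A then 1 / card A else 0)"
    using c by (simp add: prob_fun_def sum.If_cases i)
  have "relent n (\<lambda>x. if x \<in> A then 1 / card A else 0) = (\<Sum>x\<in>cube n. if x \<in> A then 1 / card A * ln (2 ^ n * (1 / card A)) else 0)"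
    unfolding relent_def by (intro sum.cong) auto
  also have "\<dots> = ln (2 ^ n * (1 / card A))"
    using c by (simp add: sum.If_cases i)
  finally show "relent n (\<lambda>x. if x \<in> A then 1 / card A else 0) = - ln (card A / 2 ^ n)"
    using c by (simp add: ln_div)
qed

text \<open>The uniform distributions on the two sides of a rectangle have relative entropies adding
  up to minus the logarithm of its measure. A larger rectangle would thus satisfy the entropy bound
  of \<open>product_ORT_error\<close> and have an error fraction above \<theta>.\<close>

lemma monochromatic_rectangle_prob_le:
  fixes b B \<theta> :: real
  assumes mono: "eps_monochromatic \<theta> 1 (unif n) (\<lambda>(x, y). Some (ORT b n x y)) (S\<^sub>1 \<times> S\<^sub>2)"
    and \<theta>: "\<theta> < 5 / 16 * tau B"
    and B: "b \<le> B" "B \<ge> 0" and n: "n > 0" "(10 / 3 * (B + 5 / 2)) ^ 4 \<le> n"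
  shows "measure_pmf.prob (unif n) (S\<^sub>1 \<times> S\<^sub>2) \<le> exp (- delta B * n)"
proof (rule ccontr)
  assume "\<not> ?thesis"
  then have big: "exp (- delta B * n) < measure_pmf.prob (unif n) (S\<^sub>1 \<times> S\<^sub>2)" by simp
  define A C where "A = cube n \<inter> S\<^sub>1" and "C = cube n \<inter> S\<^sub>2"
  have "(cube n \<times> cube n) \<inter> S\<^sub>1 \<times> S\<^sub>2 = A \<times> C" by (auto simp: A_def C_def)
  then have prob: "measure_pmf.prob (unif n) (S\<^sub>1 \<times> S\<^sub>2) = (card A / 2 ^ n) * (card C / 2 ^ n)"
    by (simp add: prob_unif card_cartesian_product power_mult_distrib[symmetric])
  have pos: "measure_pmf.prob (unif n) (S\<^sub>1 \<times> S\<^sub>2) > 0"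
    using big exp_gt_zero less_trans by blast
  then have ne: "A \<noteq> {}" "C \<noteq> {}" and c: "card A > 0" "card C > 0"
    by (auto simp: prob card_gt_0_iff A_def C_def zero_less_mult_iff zero_less_divide_iff)
  have sub: "A \<subseteq> cube n" "C \<subseteq> cube n" by (auto simp: A_def C_def)
  define \<alpha> where "\<alpha> = (\<lambda>x. if x \<in> A then 1 / real (card A) else 0)"
  define \<beta> where "\<beta> = (\<lambda>x. if x \<in> C then 1 / real (card C) else 0)"
  note \<alpha> = uniform_on_subset[OF sub(1) ne(1), folded \<alpha>_def]
  note \<beta> = uniform_on_subset[OF sub(2) ne(2), folded \<beta>_def]
  have "relent n \<alpha> + relent n \<beta> = - ln (measure_pmf.prob (unif n) (S\<^sub>1 \<times> S\<^sub>2))"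
    unfolding prob \<alpha> \<beta> using c by (subst ln_mult) auto
  also have "\<dots> \<le> delta B * n"
    using ln_mono[OF less_imp_le[OF big] exp_gt_zero] by simp
  finally have ent: "relent n \<alpha> + relent n \<beta> \<le> delta B * n" .
  let ?bad = "\<lambda>x y. if ORT b n x y = 1 then 0 else 1 :: real"
  have "5 / 16 * tau B \<le> (\<Sum>x\<in>cube n. \<Sum>y\<in>cube n. \<alpha> x * \<beta> y * ?bad x y)"
    by (rule product_ORT_error[OF \<alpha>(1) \<beta>(1) ent B n])
  also have "\<dots> = (\<Sum>x\<in>cube n. \<Sum>y\<in>cube n. 1 / (card A * card C) *
      (if (x, y) \<in> S\<^sub>1 \<times> S\<^sub>2 \<and> ORT b n x y \<noteq> 1 then 1 else 0))"
    by (intro sum.cong refl) (auto simp: \<alpha>_def \<beta>_def A_def C_def)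
  also have "\<dots> = real (card {(x, y) \<in> cube n \<times> cube n. (x, y) \<in> S\<^sub>1 \<times> S\<^sub>2 \<and> ORT b n x y \<noteq> 1}) / (card A * card C)"
    unfolding sum_distrib_left[symmetric] card_pairs_eq_sum[OF finite_cube finite_cube] by simp
  also have "{(x, y) \<in> cube n \<times> cube n. (x, y) \<in> S\<^sub>1 \<times> S\<^sub>2 \<and> ORT b n x y \<noteq> 1}
      = (cube n \<times> cube n) \<inter> (S\<^sub>1 \<times> S\<^sub>2 - ((\<lambda>(x, y). Some (ORT b n x y)) -` {Some 1} \<union> (\<lambda>(x, y). Some (ORT b n x y)) -` {None}))"
    by auto
  finally have "5 / 16 * tau B * (card A * card C) / 4 ^ n
      \<le> measure_pmf.prob (unif n) (S\<^sub>1 \<times> S\<^sub>2 - ((\<lambda>(x, y). Some (ORT b n x y)) -` {Some 1} \<union> (\<lambda>(x, y). Some (ORT b n x y)) -` {None}))"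
    unfolding prob_unif using c by (intro divide_right_mono) (simp_all add: field_simps)
  also have "\<dots> \<le> \<theta> * measure_pmf.prob (unif n) (S\<^sub>1 \<times> S\<^sub>2)"
    using mono unfolding eps_monochromatic_def .
  also have "\<dots> < 5 / 16 * tau B * measure_pmf.prob (unif n) (S\<^sub>1 \<times> S\<^sub>2)"
    using \<theta> pos by (rule mult_strict_right_mono)
  also have "\<dots> = 5 / 16 * tau B * (card A * card C) / 4 ^ n"
    by (simp add: prob power_mult_distrib[symmetric])
  finally show False by simp
qed

lemma corruption_bound_ORT_ge:
  fixes b B \<theta> :: real
  assumes b: "b \<ge> 1 / 5" and \<theta>: "0 \<le> \<theta>" "\<theta> < 5 / 16 * tau B"
    and B: "b \<le> B" and n: "n \<ge> 100" "(10 / 3 * (B + 5 / 2)) ^ 4 \<le> n"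
  shows "delta B * n \<le> corruption_bound 1 (unif n) \<theta> (\<lambda>(x, y). Some (ORT b n x y))"
proof -
  let ?g = "\<lambda>(x, y). Some (ORT b n x y)"
  define M where "M = {measure_pmf.prob (unif n) (S\<^sub>1 \<times> S\<^sub>2) | S\<^sub>1 S\<^sub>2. eps_monochromatic \<theta> 1 (unif n) ?g (S\<^sub>1 \<times> S\<^sub>2)}"
  have le: "p \<le> exp (- delta B * n)" if "p \<in> M" for p
    using that monochromatic_rectangle_prob_le[of \<theta> n b] \<theta> B b n by (auto simp: M_def)
  \<comment> \<open>A one-point rectangle on which the function is 1 shows that the supremum is
    positive; otherwise the logarithm would take its default value 0.\<close>
  obtain y where y: "y \<in> cube n" using cube_nonempty by blast
  have "real (card {x\<in>cube n. \<bar>dot n x y\<bar> \<le> sqrt n / 5}) > 0"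
    using card_small_inner_product_ge[OF y n(1)] by (rule less_le_trans[rotated]) simp
  then have "{x\<in>cube n. \<bar>dot n x y\<bar> \<le> sqrt n / 5} \<noteq> {}"
    by (metis card.empty of_nat_0 less_irrefl)
  then obtain x where x: "x \<in> cube n" "\<bar>dot n x y\<bar> \<le> sqrt n / 5" by blast
  have "1 / 5 * sqrt n \<le> b * sqrt n" using b by (intro mult_right_mono) auto
  with x have O1: "ORT b n x y = 1" by (simp add: ORT_eq)
  have "{x} \<times> {y} - (?g -` {Some 1} \<union> ?g -` {None}) = {}"
    using O1 by auto
  then have "eps_monochromatic \<theta> 1 (unif n) ?g ({x} \<times> {y})"
    using \<theta> unfolding eps_monochromatic_def by (simp only: measure_empty) simp
  then have mem: "measure_pmf.prob (unif n) ({x} \<times> {y}) \<in> M"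
    unfolding M_def by blast
  have "(cube n \<times> cube n) \<inter> {x} \<times> {y} = {(x, y)}" using x y by auto
  then have "0 < measure_pmf.prob (unif n) ({x} \<times> {y})"
    unfolding prob_unif by simp
  also have "\<dots> \<le> Sup M"
    using le mem by (intro cSup_upper bdd_aboveI[of M]) auto
  finally have pos: "Sup M > 0" .
  have "Sup M \<le> exp (- delta B * n)"
    using mem le by (intro cSup_least) auto
  from ln_mono[OF this pos] have "delta B * n \<le> - ln (Sup M)" by simp
  also have "\<dots> \<le> - ln (Sup M) / ln 2"
  proof -
    have "0 \<le> - ln (Sup M)"
      using \<open>delta B * n \<le> - ln (Sup M)\<close> delta_pos[of B] by (smt (verit) mult_nonneg_nonneg of_nat_0_le_iff)
    moreover have "ln 2 \<le> (1 :: real)"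
      using ln_le_minus_one[of "2 :: real"] by simp
    ultimately show ?thesis
      using mult_left_mono[of "ln 2" 1 "- ln (Sup M)"] by (subst pos_le_divide_eq) simp_all
  qed
  also have "\<dots> = corruption_bound 1 (unif n) \<theta> ?g"
    by (simp add: corruption_bound_def M_def log_def)
  finally show ?thesis .
qed

section \<open>Information cost\<close>

text \<open>Here \<open>f x * g y\<close> is the joint probability of the input \<open>(x, y)\<close> and one fixed transcript with
  public coins; \<open>h\<close> is the contribution of that transcript to the mutual information and \<open>e\<close> its
  contribution to the error if the output is \<open>1\<close>. The linear form of the dichotomy between large
  \<open>h\<close> and large \<open>e\<close> can be summed over all transcripts.\<close>

lemma rectangular_density_bound:
  fixes f g :: "int list \<Rightarrow> real" and b B :: real and n :: nat
  defines "p \<equiv> \<Sum>x\<in>cube n. \<Sum>y\<in>cube n. f x * g y"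
  defines "h \<equiv> \<Sum>x\<in>cube n. \<Sum>y\<in>cube n. f x * g y * ln (4 ^ n * (f x * g y) / p)"
  defines "e \<equiv> \<Sum>x\<in>cube n. \<Sum>y\<in>cube n. f x * g y * (if ORT b n x y = 1 then 0 else 1)"
  assumes f: "\<And>x. x \<in> cube n \<Longrightarrow> f x \<ge> 0" and g: "\<And>y. y \<in> cube n \<Longrightarrow> g y \<ge> 0"
    and B: "b \<le> B" "B \<ge> 0" and n: "n > 0" "(10 / 3 * (B + 5 / 2)) ^ 4 \<le> n"
  shows "h \<ge> 0" and "p \<le> e / (5 / 16 * tau B) + h / (delta B * n)"
proof -
  define F G where "F = (\<Sum>x\<in>cube n. f x)" and "G = (\<Sum>y\<in>cube n. g y)"
  have p: "p = F * G"
    unfolding p_def F_def G_def by (rule sum_product[symmetric])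
  have FG: "F \<ge> 0" "G \<ge> 0"
    unfolding F_def G_def using f g by (auto intro: sum_nonneg)
  have e0: "e \<ge> 0"
    unfolding e_def using f g by (intro sum_nonneg) auto
  have "h \<ge> 0 \<and> p \<le> e / (5 / 16 * tau B) + h / (delta B * n)"
  proof (cases "p = 0")
    case True
    then have "h = 0" by (simp add: h_def)
    then show ?thesis using True e0 tau_pos[of B] by simp
  next
    case False
    with p FG have pos: "F > 0" "G > 0" by (auto simp: less_le)
    then have p0: "p > 0" by (simp add: p)
    define \<alpha> \<beta> where "\<alpha> x = f x / F" and "\<beta> y = g y / G" for x y
    have \<alpha>: "prob_fun n \<alpha>" and \<beta>: "prob_fun n \<beta>"
      using pos f g by (auto simp: prob_fun_def \<alpha>_def \<beta>_def sum_divide_distrib[symmetric] F_def[symmetric] G_def[symmetric])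
    have fg: "f x * g y = p * (\<alpha> x * \<beta> y)" for x y
      using pos by (simp add: p \<alpha>_def \<beta>_def)
    have "h = (\<Sum>x\<in>cube n. \<Sum>y\<in>cube n. p * (\<beta> y * (\<alpha> x * ln (2 ^ n * \<alpha> x)) + \<alpha> x * (\<beta> y * ln (2 ^ n * \<beta> y))))"
      unfolding h_def
    proof (intro sum.cong refl)
      fix x y assume xy: "x \<in> cube n" "y \<in> cube n"
      show "f x * g y * ln (4 ^ n * (f x * g y) / p)
          = p * (\<beta> y * (\<alpha> x * ln (2 ^ n * \<alpha> x)) + \<alpha> x * (\<beta> y * ln (2 ^ n * \<beta> y)))"
      proof (cases "f x * g y = 0")
        case True
        then show ?thesis using pos by (auto simp: \<alpha>_def \<beta>_def)
      next
        case False
        with f[OF xy(1)] g[OF xy(2)] pos have ab: "\<alpha> x > 0" "\<beta> y > 0"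
          by (auto simp: \<alpha>_def \<beta>_def less_le)
        have "4 ^ n * (f x * g y) / p = (2 ^ n * \<alpha> x) * (2 ^ n * \<beta> y)"
          using p0 by (simp add: fg power_mult_distrib[symmetric] mult_ac)
        then have "ln (4 ^ n * (f x * g y) / p) = ln (2 ^ n * \<alpha> x) + ln (2 ^ n * \<beta> y)"
          using ab by (simp only: ln_mult_pos mult_pos_pos zero_less_power zero_less_numeral)
        then show ?thesis by (simp add: fg algebra_simps)
      qed
    qed
    also have "\<dots> = p * ((\<Sum>y\<in>cube n. \<beta> y) * relent n \<alpha> + (\<Sum>x\<in>cube n. \<alpha> x) * relent n \<beta>)"
    proof -
      have "(\<Sum>x\<in>cube n. \<Sum>y\<in>cube n. \<beta> y * (\<alpha> x * ln (2 ^ n * \<alpha> x))) = (\<Sum>y\<in>cube n. \<beta> y) * relent n \<alpha>"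
        unfolding relent_def sum_product by (rule sum.swap)
      moreover have "(\<Sum>x\<in>cube n. \<Sum>y\<in>cube n. \<alpha> x * (\<beta> y * ln (2 ^ n * \<beta> y))) = (\<Sum>x\<in>cube n. \<alpha> x) * relent n \<beta>"
        unfolding relent_def sum_product ..
      ultimately show ?thesis
        by (simp only: sum_distrib_left[symmetric] sum.distrib)
    qed
    finally have h: "h = p * (relent n \<alpha> + relent n \<beta>)"
      using \<alpha> \<beta> by (simp add: prob_fun_def)
    have e: "e = p * (\<Sum>x\<in>cube n. \<Sum>y\<in>cube n. \<alpha> x * \<beta> y * (if ORT b n x y = 1 then 0 else 1))"
      unfolding e_def fg sum_distrib_left by (simp only: mult.assoc)
    have h0: "h \<ge> 0"
      using h p0 relent_nonneg[OF \<alpha>] relent_nonneg[OF \<beta>] by simp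
    have dn: "delta B * n > 0" using delta_pos n by simp
    have t0: "5 / 16 * tau B > 0" using tau_pos[of B] by simp
    show ?thesis
    proof (cases "relent n \<alpha> + relent n \<beta> \<le> delta B * n")
      case True
      have "p * (5 / 16 * tau B) \<le> e"
        unfolding e using p0 by (intro mult_left_mono product_ORT_error[OF \<alpha> \<beta> True B n]) auto
      then have "p \<le> e / (5 / 16 * tau B)"
        using t0 by (subst pos_le_divide_eq)
      then show ?thesis using h0 dn by (simp add: add_increasing2)
    next
      case False
      then have "p * (delta B * n) \<le> h"
        unfolding h using p0 by (intro mult_left_mono) auto
      then have "p \<le> h / (delta B * n)"
        using dn by (subst pos_le_divide_eq)
      moreover have "e / (5 / 16 * tau B) \<ge> 0" using e0 t0 by (intro divide_nonneg_pos)
      ultimately show ?thesis using h0 by linarith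
    qed
  qed
  then show "h \<ge> 0" "p \<le> e / (5 / 16 * tau B) + h / (delta B * n)" by auto
qed

section \<open>Protocol trees\<close>

text \<open>The rectangle property: at each node the test of the sent bit joins the speaker's
  predicate, and both predicates then continue in the chosen subtree.\<close>

lemma run_rectangular:
  "\<exists>C\<^sub>A C\<^sub>B. \<forall>x y r r\<^sub>A r\<^sub>B m. run T x y r r\<^sub>A r\<^sub>B = m \<longleftrightarrow> C\<^sub>A x r r\<^sub>A m \<and> C\<^sub>B y r r\<^sub>B m"
proof (induction T)
  case (Leaf z)
  show ?case
    by (intro exI[of _ "\<lambda>x r r\<^sub>A m. m = []"] exI[of _ "\<lambda>y r r\<^sub>B m. True"]) auto
next
  case (Alice f T\<^sub>0 T\<^sub>1)
  from Alice.IH obtain A\<^sub>0 B\<^sub>0 A\<^sub>1 B\<^sub>1 where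
    IH: "\<forall>x y r r\<^sub>A r\<^sub>B m. run T\<^sub>0 x y r r\<^sub>A r\<^sub>B = m \<longleftrightarrow> A\<^sub>0 x r r\<^sub>A m \<and> B\<^sub>0 y r r\<^sub>B m"
      "\<forall>x y r r\<^sub>A r\<^sub>B m. run T\<^sub>1 x y r r\<^sub>A r\<^sub>B = m \<longleftrightarrow> A\<^sub>1 x r r\<^sub>A m \<and> B\<^sub>1 y r r\<^sub>B m"
    by (elim exE)
  show ?case
  proof (intro exI allI)
    fix x y r r\<^sub>A r\<^sub>B m
    show "run (Alice f T\<^sub>0 T\<^sub>1) x y r r\<^sub>A r\<^sub>B = m \<longleftrightarrow>
        (\<lambda>x r r\<^sub>A m. m \<noteq> [] \<and> f x r\<^sub>A r = hd m \<and> (if hd m then A\<^sub>1 x r r\<^sub>A (tl m) else A\<^sub>0 x r r\<^sub>A (tl m))) x r r\<^sub>A m \<and>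
        (\<lambda>y r r\<^sub>B m. if hd m then B\<^sub>1 y r r\<^sub>B (tl m) else B\<^sub>0 y r r\<^sub>B (tl m)) y r r\<^sub>B m"
      by (cases m) (auto simp: IH)
  qed
next
  case (Bob f T\<^sub>0 T\<^sub>1)
  from Bob.IH obtain A\<^sub>0 B\<^sub>0 A\<^sub>1 B\<^sub>1 where
    IH: "\<forall>x y r r\<^sub>A r\<^sub>B m. run T\<^sub>0 x y r r\<^sub>A r\<^sub>B = m \<longleftrightarrow> A\<^sub>0 x r r\<^sub>A m \<and> B\<^sub>0 y r r\<^sub>B m"
      "\<forall>x y r r\<^sub>A r\<^sub>B m. run T\<^sub>1 x y r r\<^sub>A r\<^sub>B = m \<longleftrightarrow> A\<^sub>1 x r r\<^sub>A m \<and> B\<^sub>1 y r r\<^sub>B m"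
    by (elim exE)
  show ?case
  proof (intro exI allI)
    fix x y r r\<^sub>A r\<^sub>B m
    show "run (Bob f T\<^sub>0 T\<^sub>1) x y r r\<^sub>A r\<^sub>B = m \<longleftrightarrow>
        (\<lambda>x r r\<^sub>A m. if hd m then A\<^sub>1 x r r\<^sub>A (tl m) else A\<^sub>0 x r r\<^sub>A (tl m)) x r r\<^sub>A m \<and>
        (\<lambda>y r r\<^sub>B m. m \<noteq> [] \<and> f y r\<^sub>B r = hd m \<and> (if hd m then B\<^sub>1 y r r\<^sub>B (tl m) else B\<^sub>0 y r r\<^sub>B (tl m))) y r r\<^sub>B m"
      by (cases m) (auto simp: IH)
  qed
qed

lemma exists_exact_tree:
  fixes F :: "'x \<Rightarrow> 'y \<Rightarrow> 'z"
  assumes "finite S\<^sub>1" "finite S\<^sub>2"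
  shows "\<exists>T :: ('x, 'y, 'z) ptree. \<forall>x\<in>S\<^sub>1. \<forall>y\<in>S\<^sub>2. \<forall>r r\<^sub>A r\<^sub>B. out T (run T x y r r\<^sub>A r\<^sub>B) = F x y"
  using assms(1)
proof (induction S\<^sub>1 rule: finite_induct)
  case (insert a S\<^sub>1)
  from assms(2) have "\<exists>T :: ('x, 'y, 'z) ptree. \<forall>y\<in>S\<^sub>2. \<forall>x r r\<^sub>A r\<^sub>B. out T (run T x y r r\<^sub>A r\<^sub>B) = F a y"
  proof (induction S\<^sub>2 rule: finite_induct)
    case (insert c S\<^sub>2)
    then obtain T :: "('x, 'y, 'z) ptree" where "\<forall>y\<in>S\<^sub>2. \<forall>x r r\<^sub>A r\<^sub>B. out T (run T x y r r\<^sub>A r\<^sub>B) = F a y"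
      by blast
    then show ?case
      by (intro exI[of _ "Bob (\<lambda>y _ _. y = c) T (Leaf (F a c))"]) auto
  qed auto
  then obtain T' :: "('x, 'y, 'z) ptree" where T': "\<forall>y\<in>S\<^sub>2. \<forall>x r r\<^sub>A r\<^sub>B. out T' (run T' x y r r\<^sub>A r\<^sub>B) = F a y"
    by (elim exE)
  obtain T :: "('x, 'y, 'z) ptree" where T: "\<forall>x\<in>S\<^sub>1. \<forall>y\<in>S\<^sub>2. \<forall>r r\<^sub>A r\<^sub>B. out T (run T x y r r\<^sub>A r\<^sub>B) = F x y"
    using insert.IH by blast
  from T T' show ?case
    by (intro exI[of _ "Alice (\<lambda>x _ _. x = a) T T'"]) auto
qed auto

text \<open>This makes the set in the definition of \<open>IC\<close> nonempty, so that a lower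
  bound for every protocol passes to the infimum. In the tree, Alice and then Bob compare their
  inputs with the finitely many candidates one by one.\<close>

lemma exists_computing_protocol:
  fixes F :: "'x \<Rightarrow> 'y \<Rightarrow> 'z"
  assumes "finite S\<^sub>1" "finite S\<^sub>2" "set_pmf \<mu> \<subseteq> S\<^sub>1 \<times> S\<^sub>2" "\<epsilon> \<ge> 0"
  shows "\<exists>P. computes \<mu> P (\<lambda>(x, y). Some (F x y)) \<epsilon>"
proof -
  obtain T :: "('x, 'y, 'z) ptree" where T: "\<forall>x\<in>S\<^sub>1. \<forall>y\<in>S\<^sub>2. \<forall>r r\<^sub>A r\<^sub>B. out T (run T x y r r\<^sub>A r\<^sub>B) = F x y"
    using exists_exact_tree[OF assms(1,2)] by blast
  define P where "P = Protocol (return_pmf []) (return_pmf []) (return_pmf []) T"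
  have "measure_pmf.prob (execution \<mu> P)
      {\<omega>. (\<lambda>(x, y). Some (F x y)) (fst \<omega>) \<noteq> None \<and>
        Some (out (tree P) (transcript P \<omega>)) \<noteq> (\<lambda>(x, y). Some (F x y)) (fst \<omega>)} = 0"
    unfolding measure_pmf_zero_iff using T assms(3)
    by (force simp: execution_def transcript_def P_def)
  then have "computes \<mu> P (\<lambda>(x, y). Some (F x y)) \<epsilon>"
    unfolding computes_def using assms(4) by simp
  then show ?thesis by blast
qed

section \<open>Mutual information of discrete variables\<close>

lemma distributed_pmf: "distributed (measure_pmf M) (count_space UNIV) X (pmf (map_pmf X M))"
proof -
  have "distr (measure_pmf M) (count_space UNIV) X = density (count_space UNIV) (pmf (map_pmf X M))"
    by (simp add: map_pmf_rep_eq[symmetric] measure_pmf_eq_density[symmetric])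
  then show ?thesis
    by (simp add: distributed_def)
qed

lemma mutual_information_pmf:
  fixes X :: "'a \<Rightarrow> 'b :: countable" and Y :: "'a \<Rightarrow> 'c :: countable"
  shows "prob_space.mutual_information (measure_pmf M) 2 (count_space UNIV) (count_space UNIV) X Y =
    (\<integral>w. pmf (map_pmf (\<lambda>\<omega>. (X \<omega>, Y \<omega>)) M) w * log 2 (pmf (map_pmf (\<lambda>\<omega>. (X \<omega>, Y \<omega>)) M) w /
      (pmf (map_pmf X M) (fst w) * pmf (map_pmf Y M) (snd w))) \<partial>count_space UNIV)"
proof -
  interpret information_space "measure_pmf M" 2
    by unfold_locales (simp_all add: measure_pmf.emeasure_space_1)
  have pair: "count_space UNIV \<Otimes>\<^sub>M count_space UNIV = (count_space UNIV :: ('b \<times> 'c) measure)"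
    by (simp add: pair_measure_countable)
  have "distributed (measure_pmf M) (count_space UNIV \<Otimes>\<^sub>M count_space UNIV) (\<lambda>\<omega>. (X \<omega>, Y \<omega>))
      (pmf (map_pmf (\<lambda>\<omega>. (X \<omega>, Y \<omega>)) M))"
    unfolding pair by (rule distributed_pmf)
  from mutual_information_distr[OF _ _ distributed_pmf _ distributed_pmf _ this] show ?thesis
    by (simp add: sigma_finite_measure_count_space pair)
qed

lemma pmf_le_pmf_map: "pmf J w \<le> pmf (map_pmf f J) (f w)"
proof -
  have "pmf J w = measure_pmf.prob J {w}" by (simp add: measure_pmf_single)
  also have "\<dots> \<le> measure_pmf.prob J (f -` {f w})"
    by (intro measure_pmf.finite_measure_mono) auto
  finally show ?thesis by (simp add: pmf_map)
qed

text \<open>The public coins may have infinite support, and a non-integrable integrand would have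
  integral 0 by default. Finiteness of the first marginal's support bounds the density ratio by a
  constant \<open>K\<close>; from below, ln u \<le> u - 1 bounds the negative part by the product of
  the marginals.\<close>

lemma integrable_information_density:
  fixes J :: "('b \<times> 'c) pmf"
  assumes "finite (set_pmf (map_pmf fst J))"
  shows "integrable (count_space UNIV)
    (\<lambda>w. pmf J w * ln (pmf J w / (pmf (map_pmf fst J) (fst w) * pmf (map_pmf snd J) (snd w))))"
proof -
  let ?J1 = "map_pmf fst J" and ?J2 = "map_pmf snd J"
  define K where "K = 1 + (\<Sum>x\<in>set_pmf ?J1. 1 / pmf ?J1 x)"
  have K: "1 / pmf ?J1 x \<le> K" if "x \<in> set_pmf ?J1" for x
  proof -
    have "1 / pmf ?J1 x \<le> (\<Sum>x\<in>set_pmf ?J1. 1 / pmf ?J1 x)"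
      using assms that by (intro member_le_sum) auto
    then show ?thesis by (simp add: K_def)
  qed
  have K1: "K \<ge> 1" by (simp add: K_def sum_nonneg)
  show ?thesis
  proof (rule Bochner_Integration.integrable_bound)
    show "integrable (count_space UNIV) (\<lambda>w. pmf J w * ln K + pmf (pair_pmf ?J1 ?J2) w)"
      by (intro Bochner_Integration.integrable_add integrable_mult_left integrable_pmf)
    show "AE w in count_space UNIV. norm (pmf J w * ln (pmf J w / (pmf ?J1 (fst w) * pmf ?J2 (snd w))))
        \<le> norm (pmf J w * ln K + pmf (pair_pmf ?J1 ?J2) w)"
    proof (rule AE_I2)
      fix w
      let ?j = "pmf J w" and ?m = "pmf ?J1 (fst w) * pmf ?J2 (snd w)"
      have m: "pmf (pair_pmf ?J1 ?J2) w = ?m" by (cases w) (simp add: pmf_pair)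
      have "\<bar>?j * ln (?j / ?m)\<bar> \<le> ?j * ln K + ?m"
      proof (cases "?j = 0")
        case False
        then have j: "?j > 0" by (simp add: pmf_pos)
        then have j12: "pmf ?J1 (fst w) > 0" "pmf ?J2 (snd w) > 0"
          using pmf_le_pmf_map[of J w fst] pmf_le_pmf_map[of J w snd] by linarith+
        then have m0: "?m > 0" by simp
        have "?j / ?m \<le> pmf ?J2 (snd w) / ?m"
          using m0 pmf_le_pmf_map[of J w snd] by (intro divide_right_mono) auto
        also have "\<dots> = 1 / pmf ?J1 (fst w)" using j12 by simp
        also have "\<dots> \<le> K" using j12 by (intro K) (simp add: set_pmf_iff del: set_map_pmf)
        finally have "ln (?j / ?m) \<le> ln K" using j m0 by (intro ln_mono) auto
        then have 1: "?j * ln (?j / ?m) \<le> ?j * ln K" using j by simp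
        have "ln (?m / ?j) \<le> ?m / ?j - 1" using j m0 by (intro ln_le_minus_one) simp
        then have "?j * ln (?m / ?j) \<le> ?j * (?m / ?j - 1)" using j by simp
        also have "\<dots> = ?m - ?j" using j by (simp add: right_diff_distrib)
        also have "ln (?m / ?j) = - ln (?j / ?m)"
          using ln_inverse[of "?j / ?m"] by (simp only: inverse_divide)
        finally have "- (?j * ln (?j / ?m)) \<le> ?m - ?j" by (simp only: mult_minus_right)
        moreover have "?j * ln K \<ge> 0" using j K1 by simp
        ultimately show ?thesis using 1 j m0 unfolding abs_le_iff by linarith
      qed simp
      moreover have "?j * ln K + ?m \<ge> 0" using K1 by (intro add_nonneg_nonneg mult_nonneg_nonneg) auto
      ultimately show "norm (?j * ln (?j / ?m)) \<le> norm (?j * ln K + pmf (pair_pmf ?J1 ?J2) w)"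
        unfolding m by simp
    qed
  qed simp
qed

lemma integral_count_space_Times:
  fixes f :: "('b :: countable \<times> 'c :: countable) \<Rightarrow> real"
  assumes "integrable (count_space (A \<times> B)) f" "finite A"
  shows "(\<integral>w. f w \<partial>count_space (A \<times> B)) = (\<integral>q. (\<Sum>x\<in>A. f (x, q)) \<partial>count_space B)"
    and "integrable (count_space B) (\<lambda>q. \<Sum>x\<in>A. f (x, q))"
proof -
  interpret A: sigma_finite_measure "count_space A"
    by (rule sigma_finite_measure_count_space_countable) simp
  interpret B: sigma_finite_measure "count_space B"
    by (rule sigma_finite_measure_count_space_countable) simp
  interpret pair_sigma_finite "count_space A" "count_space B" ..
  have pair: "count_space A \<Otimes>\<^sub>M count_space B = count_space (A \<times> B)"
    by (simp add: pair_measure_countable)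
  have int: "integrable (count_space A \<Otimes>\<^sub>M count_space B) (\<lambda>(x, q). f (x, q))"
    using assms by (simp add: pair)
  have sum: "(\<integral>x. f (x, q) \<partial>count_space A) = (\<Sum>x\<in>A. f (x, q))" for q
    using assms(2) by (rule lebesgue_integral_count_space_finite)
  show "(\<integral>w. f w \<partial>count_space (A \<times> B)) = (\<integral>q. (\<Sum>x\<in>A. f (x, q)) \<partial>count_space B)"
    using integral_snd[OF int] by (simp add: sum pair)
  show "integrable (count_space B) (\<lambda>q. \<Sum>x\<in>A. f (x, q))"
    using integrable_snd[OF int] by (simp add: sum)
qed

text \<open>Mutual information in nats, split into the contributions of the single values of
  \<open>Y\<close>; the factor \<open>ln 2\<close> converts from bits.\<close>

lemma mutual_information_finite_pmf:
  fixes X :: "'a \<Rightarrow> 'b :: countable" and Y :: "'a \<Rightarrow> 'c :: countable"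
  defines "h \<equiv> \<lambda>M A q. \<Sum>x\<in>A. pmf (map_pmf (\<lambda>\<omega>. (X \<omega>, Y \<omega>)) M) (x, q) *
      ln (pmf (map_pmf (\<lambda>\<omega>. (X \<omega>, Y \<omega>)) M) (x, q) / (pmf (map_pmf X M) x * pmf (map_pmf Y M) q))"
  assumes A: "finite A" "set_pmf (map_pmf X M) \<subseteq> A"
  shows "ln 2 * prob_space.mutual_information (measure_pmf M) 2 (count_space UNIV) (count_space UNIV) X Y
      = (\<integral>q. h M A q \<partial>count_space UNIV)"
    and "integrable (count_space UNIV) (h M A)"
proof -
  define J where "J = map_pmf (\<lambda>\<omega>. (X \<omega>, Y \<omega>)) M"
  have J1: "map_pmf fst J = map_pmf X M" and J2: "map_pmf snd J = map_pmf Y M"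
    by (simp_all add: J_def map_pmf_comp)
  define f where "f w = pmf J w * ln (pmf J w / (pmf (map_pmf X M) (fst w) * pmf (map_pmf Y M) (snd w)))" for w
  have int: "integrable (count_space UNIV) f"
    using integrable_information_density[of J] finite_subset[OF A(2,1)] unfolding f_def J1 J2 by blast
  have f0: "f w = 0" if "w \<notin> A \<times> UNIV" for w
  proof -
    have "fst w \<notin> set_pmf (map_pmf fst J)" using that A by (cases w) (auto simp: J1)
    then have "pmf J w = 0"
      using pmf_le_pmf_map[of J w fst] by (simp add: set_pmf_iff del: set_map_pmf)
    then show ?thesis by (simp add: f_def)
  qed
  have restr: "count_space (A \<times> UNIV) = restrict_space (count_space UNIV) (A \<times> (UNIV :: 'c set))"
    by (simp add: restrict_count_space)
  have ind: "(\<lambda>w. indicator (A \<times> UNIV) w *\<^sub>R f w) = f"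
    using f0 by (auto simp: fun_eq_iff indicator_def)
  have int': "integrable (count_space (A \<times> UNIV)) f"
    unfolding restr using int by (subst integrable_restrict_space) (simp_all only: ind, simp_all)
  have eq: "(\<integral>w. f w \<partial>count_space UNIV) = (\<integral>w. f w \<partial>count_space (A \<times> UNIV))"
    unfolding restr by (subst integral_restrict_space) (simp_all only: ind, simp_all)
  have h: "h M A = (\<lambda>q. \<Sum>x\<in>A. f (x, q))"
    by (simp add: h_def f_def J_def)
  have "ln 2 * prob_space.mutual_information (measure_pmf M) 2 (count_space UNIV) (count_space UNIV) X Y
      = (\<integral>w. f w \<partial>count_space UNIV)"
    unfolding mutual_information_pmf J_def[symmetric] f_def integral_mult_right_zero[symmetric]
    by (simp add: log_def)
  then show "ln 2 * prob_space.mutual_information (measure_pmf M) 2 (count_space UNIV) (count_space UNIV) X Y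
      = (\<integral>q. h M A q \<partial>count_space UNIV)"
    unfolding h eq using integral_count_space_Times(1)[OF int' A(1)] by simp
  show "integrable (count_space UNIV) (h M A)"
    unfolding h by (rule integral_count_space_Times(2)[OF int' A(1)])
qed

lemma mutual_information_pair_pmf:
  fixes \<mu> :: "'b :: countable pmf" and \<nu> :: "'c :: countable pmf"
  assumes "map_pmf (\<lambda>\<omega>. (X \<omega>, Y \<omega>)) M = pair_pmf \<mu> \<nu>"
  shows "prob_space.mutual_information (measure_pmf M) 2 (count_space UNIV) (count_space UNIV) X Y = 0"
proof -
  have X: "map_pmf X M = \<mu>" and Y: "map_pmf Y M = \<nu>"
    using arg_cong[OF assms, of "map_pmf fst"] arg_cong[OF assms, of "map_pmf snd"]
    by (simp_all add: map_pmf_comp map_fst_pair_pmf map_snd_pair_pmf)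
  have zero: "pmf (pair_pmf \<mu> \<nu>) w * log 2 (pmf (pair_pmf \<mu> \<nu>) w / (pmf \<mu> (fst w) * pmf \<nu> (snd w))) = 0" for w
    by (cases w) (simp add: pmf_pair)
  show ?thesis
    unfolding mutual_information_pmf assms X Y zero by simp
qed

section \<open>Information cost of protocols\<close>

lemma map_pmf_execution_input: "map_pmf fst (execution \<mu> P) = \<mu>"
  by (simp add: execution_def map_fst_pair_pmf)

text \<open>Since the input is independent of the public coins, the conditional mutual information is
  the mutual information of the input and the pair of transcript and public coins.\<close>

lemma icost_eq_mutual_information:
  fixes \<mu> :: "('x :: countable \<times> 'y :: countable) pmf"
  shows "icost \<mu> P = prob_space.mutual_information (measure_pmf (execution \<mu> P)) 2
    (count_space UNIV) (count_space UNIV) fst (\<lambda>\<omega>. (transcript P \<omega>, fst (snd \<omega>)))"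
proof -
  let ?E = "execution \<mu> P"
  have XR: "(\<lambda>((x :: 'x, y :: 'y), r :: coins, r\<^sub>A :: coins, r\<^sub>B :: coins). (x, y)) = fst"
    "(\<lambda>((x :: 'x, y :: 'y), r :: coins, r\<^sub>A :: coins, r\<^sub>B :: coins). r) = (\<lambda>\<omega>. fst (snd \<omega>))"
    by (auto simp: fun_eq_iff)
  have "map_pmf (\<lambda>\<omega>. (fst \<omega>, fst (snd \<omega>))) ?E = map_pmf (apsnd fst) ?E"
    by (intro map_pmf_cong refl) (auto simp: apsnd_def)
  also have "\<dots> = pair_pmf \<mu> (public_coins P)"
    by (simp add: execution_def pair_map_pmf2[symmetric] map_fst_pair_pmf)
  finally have "prob_space.mutual_information (measure_pmf ?E) 2 (count_space UNIV) (count_space UNIV) fst (\<lambda>\<omega>. fst (snd \<omega>)) = 0"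
    by (rule mutual_information_pair_pmf)
  moreover have "count_space UNIV \<Otimes>\<^sub>M count_space UNIV = (count_space UNIV :: (bool list \<times> coins) measure)"
    by (simp add: pair_measure_countable)
  ultimately show ?thesis
    unfolding icost_def prob_space.conditional_mutual_information_def[OF prob_space_measure_pmf] XR by simp
qed

text \<open>For fixed input and public coins the two private coin strings are independent, so the
  rectangle property turns the probability of a transcript into a product. Here \<open>q\<close>
  pairs transcript and public coins; the probability of the latter is put into
  \<open>f\<close>.\<close>

lemma execution_transcript_pmf:
  fixes P :: "('x :: countable, 'y :: countable, 'z) protocol"
  obtains f g where "\<And>x q. f x q \<ge> (0 :: real)" "\<And>y q. g y q \<ge> (0 :: real)"
    "\<And>x y q. pmf (map_pmf (\<lambda>\<omega>. (fst \<omega>, (transcript P \<omega>, fst (snd \<omega>)))) (execution \<mu> P)) ((x, y), q)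
      = pmf \<mu> (x, y) * (f x q * g y q)"
proof -
  obtain C\<^sub>A C\<^sub>B where C: "\<And>x y r r\<^sub>A r\<^sub>B m. run (tree P) x y r r\<^sub>A r\<^sub>B = m \<longleftrightarrow> C\<^sub>A x r r\<^sub>A m \<and> C\<^sub>B y r r\<^sub>B m"
    using run_rectangular[of "tree P"] by (elim exE) blast
  have C': "C\<^sub>A x r r\<^sub>A (run (tree P) x y r r\<^sub>A r\<^sub>B)" "C\<^sub>B y r r\<^sub>B (run (tree P) x y r r\<^sub>A r\<^sub>B)" for x y r r\<^sub>A r\<^sub>B
    using C by blast+
  define f where "f x q = pmf (public_coins P) (snd q) * measure_pmf.prob (alice_coins P) {r\<^sub>A. C\<^sub>A x (snd q) r\<^sub>A (fst q)}" for x q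
  define g where "g y q = measure_pmf.prob (bob_coins P) {r\<^sub>B. C\<^sub>B y (snd q) r\<^sub>B (fst q)}" for y q
  have "pmf (map_pmf (\<lambda>\<omega>. (fst \<omega>, (transcript P \<omega>, fst (snd \<omega>)))) (execution \<mu> P)) ((x, y), q)
      = pmf \<mu> (x, y) * (f x q * g y q)" for x y q
  proof -
    have "(\<lambda>\<omega>. (fst \<omega>, (transcript P \<omega>, fst (snd \<omega>)))) -` {((x, y), q)}
        = {(x, y)} \<times> ({snd q} \<times> ({r\<^sub>A. C\<^sub>A x (snd q) r\<^sub>A (fst q)} \<times> {r\<^sub>B. C\<^sub>B y (snd q) r\<^sub>B (fst q)}))"
    proof -
      obtain m r where q: "q = (m, r)" by (cases q)
      show ?thesis unfolding q by (auto simp: transcript_def C C')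
    qed
    then show ?thesis
      by (simp add: pmf_map execution_def measure_pmf_prob_product measure_pmf_single f_def g_def)
  qed
  then show thesis
    by (intro that[of f g]) (auto simp: f_def g_def)
qed

lemma prob_ORT_eq_1_ge:
  assumes b: "b \<ge> 1 / 5" and n: "n \<ge> 100"
  shows "1 / 84 \<le> measure_pmf.prob (unif n) {(x, y). ORT b n x y = 1}"
proof -
  have "2 ^ n * (2 ^ n / 84) = (\<Sum>y\<in>cube n. 2 ^ n / 84 :: real)"
    by (simp add: card_cube)
  also have "\<dots> \<le> (\<Sum>y\<in>cube n. \<Sum>x\<in>cube n. if ORT b n x y = 1 then 1 else 0)"
  proof (intro sum_mono)
    fix y assume "y \<in> cube n"
    then have "2 ^ n / 84 \<le> real (card {x\<in>cube n. \<bar>dot n x y\<bar> \<le> sqrt n / 5})"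
      using n by (rule card_small_inner_product_ge)
    also have "\<dots> \<le> real (card {x\<in>cube n. ORT b n x y = 1})"
    proof (intro of_nat_mono card_mono)
      have "1 / 5 * sqrt n \<le> b * sqrt n" using b by (intro mult_right_mono) auto
      then show "{x\<in>cube n. \<bar>dot n x y\<bar> \<le> sqrt n / 5} \<subseteq> {x\<in>cube n. ORT b n x y = 1}"
        by (auto simp: ORT_eq)
    qed simp
    also have "\<dots> = (\<Sum>x\<in>cube n. if ORT b n x y = 1 then 1 else 0)"
      by (simp add: sum.If_cases Int_def)
    finally show "2 ^ n / 84 \<le> (\<Sum>x\<in>cube n. if ORT b n x y = 1 then 1 else 0 :: real)" .
  qed
  also have "\<dots> = (\<Sum>x\<in>cube n. \<Sum>y\<in>cube n. if ORT b n x y = 1 then 1 else 0)"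
    by (rule sum.swap)
  also have "\<dots> = real (card {(x, y) \<in> cube n \<times> cube n. ORT b n x y = 1})"
    by (rule card_pairs_eq_sum[symmetric]) auto
  also have "{(x, y) \<in> cube n \<times> cube n. ORT b n x y = 1} = (cube n \<times> cube n) \<inter> {(x, y). ORT b n x y = 1}"
    by auto
  finally show ?thesis
    unfolding prob_unif by (simp add: field_simps power_mult_distrib[symmetric])
qed

text \<open>\<open>rectangular_density_bound\<close> is summed over all \<open>q\<close> with output
  1. Their total probability is at least 1/84 minus the error, while the error part of the upper
  bound is at most 1/400; the information cost has to supply the rest.\<close>

lemma icost_ORT_ge:
  fixes b B \<theta> :: real
  assumes P: "computes (unif n) P (\<lambda>(x, y). Some (ORT b n x y)) (\<theta> / 400)"
    and b: "b \<ge> 1 / 5" and \<theta>: "\<theta> < 5 / 16 * tau B"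
    and B: "b \<le> B" and n: "n \<ge> 100" "(10 / 3 * (B + 5 / 2)) ^ 4 \<le> n"
  shows "delta B / 200 * n \<le> icost (unif n) P"
proof -
  define E where "E = execution (unif n) P"
  define Y where "Y \<omega> = (transcript P \<omega>, fst (snd \<omega>))" for \<omega> :: "(int list \<times> int list) \<times> coins \<times> coins \<times> coins"
  define J where "J = map_pmf (\<lambda>\<omega>. (fst \<omega>, Y \<omega>)) E"
  define p where "p = pmf (map_pmf Y E)"
  define A where "A = cube n \<times> cube n"
  define Bad where "Bad = A \<inter> {(x, y). ORT b n x y \<noteq> 1}"
  define h where "h = (\<lambda>q. \<Sum>w\<in>A. pmf J (w, q) * ln (pmf J (w, q) / (pmf (unif n) w * p q)))"
  define e where "e q = (\<Sum>w\<in>Bad. pmf J (w, q))" for q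
  define t where "t = 5 / 16 * tau B"
  define d where "d = delta B * n"
  define err where "err = {\<omega> :: (int list \<times> int list) \<times> coins \<times> coins \<times> coins. out (tree P) (transcript P \<omega>) \<noteq> ORT b n (fst (fst \<omega>)) (snd (fst \<omega>))}"
  define O1 where "O1 = {q :: bool list \<times> coins. out (tree P) (fst q) = 1}"
  have t: "t > 0" and d: "d > 0" and \<theta>t: "\<theta> < t"
    using tau_pos[of B] delta_pos[of B] n \<theta> by (auto simp: t_def d_def)
  have B0: "B \<ge> 0" and n0: "n > 0" using b B n by auto
  have finA: "finite A" by (simp add: A_def)
  have finBad: "finite Bad" using finA by (simp add: Bad_def)
  have unif_pmf: "pmf (unif n) w = 1 / 4 ^ n" if "w \<in> A" for w
    using that cube_nonempty[of n] unfolding unif_def A_def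
    by (subst pmf_of_set) (auto simp: card_cartesian_product card_cube power_mult_distrib[symmetric])
  have setA: "set_pmf (unif n) = A"
    unfolding unif_def A_def using cube_nonempty[of n] by (intro set_pmf_of_set) auto
  have mapX: "map_pmf fst E = unif n"
    by (simp add: E_def map_pmf_execution_input)

  have mi: "ln 2 * icost (unif n) P = (\<integral>q. h q \<partial>count_space UNIV)" and int_h: "integrable (count_space UNIV) h"
    using mutual_information_finite_pmf[OF finA, of fst E Y] setA
    by (simp_all only: icost_eq_mutual_information mapX E_def[symmetric] Y_def[symmetric] h_def J_def p_def subset_refl)

  obtain f g where f: "\<And>x q. f x q \<ge> (0 :: real)" and g: "\<And>y q. g y q \<ge> (0 :: real)"
    and J: "\<And>x y q. pmf J ((x, y), q) = pmf (unif n) (x, y) * (f x q * g y q)"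
    using execution_transcript_pmf[of P "unif n"] unfolding J_def E_def Y_def by blast
  have p_eq: "p q = (\<Sum>w\<in>A. pmf J (w, q))" for q
  proof -
    have "set_pmf J \<inter> snd -` {q} = set_pmf J \<inter> (\<lambda>w. (w, q)) ` A"
    proof -
      have "fst ` set_pmf J \<subseteq> A"
        using set_map_pmf[of fst J] setA mapX by (simp add: J_def map_pmf_comp)
      then show ?thesis by force
    qed
    then have "measure_pmf.prob J (snd -` {q}) = measure_pmf.prob J ((\<lambda>w. (w, q)) ` A)"
      by (metis measure_Int_set_pmf inf_commute)
    also have "\<dots> = (\<Sum>w\<in>(\<lambda>w. (w, q)) ` A. pmf J w)"
      using finA by (intro measure_measure_pmf_finite) auto
    also have "\<dots> = (\<Sum>w\<in>A. pmf J (w, q))"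
      by (subst sum.reindex) (auto simp: inj_on_def)
    finally have "pmf (map_pmf snd J) q = (\<Sum>w\<in>A. pmf J (w, q))"
      by (simp add: pmf_map)
    moreover have "map_pmf snd J = map_pmf Y E"
      by (simp add: J_def map_pmf_comp)
    ultimately show ?thesis by (simp add: p_def)
  qed

  have key: "h q \<ge> 0" "p q \<le> e q / t + h q / d" for q
  proof -
    \<comment> \<open>The uniform input probability is absorbed into one factor.\<close>
    define f' where "f' x = f x q / 4 ^ n" for x
    have Jf: "pmf J ((x, y), q) = f' x * g y q" if "x \<in> cube n" "y \<in> cube n" for x y
      using that unif_pmf[of "(x, y)"] by (simp add: J f'_def A_def)
    have sumA: "(\<Sum>w\<in>A. F w) = (\<Sum>x\<in>cube n. \<Sum>y\<in>cube n. F (x, y))" for F :: "_ \<Rightarrow> real"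
      by (simp add: A_def sum.cartesian_product)
    have pq: "p q = (\<Sum>x\<in>cube n. \<Sum>y\<in>cube n. f' x * g y q)"
      unfolding p_eq sumA by (intro sum.cong refl Jf)
    have hq: "h q = (\<Sum>x\<in>cube n. \<Sum>y\<in>cube n. f' x * g y q * ln (4 ^ n * (f' x * g y q) / p q))"
      unfolding h_def sumA
    proof (intro sum.cong refl)
      fix x y assume "x \<in> cube n" "y \<in> cube n"
      then show "pmf J ((x, y), q) * ln (pmf J ((x, y), q) / (pmf (unif n) (x, y) * p q))
          = f' x * g y q * ln (4 ^ n * (f' x * g y q) / p q)"
        using unif_pmf[of "(x, y)"] by (simp add: Jf A_def mult_ac)
    qed
    have "e q = (\<Sum>w\<in>A. pmf J (w, q) * (if ORT b n (fst w) (snd w) = 1 then 0 else 1))"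
      unfolding e_def Bad_def using finA by (intro sum.mono_neutral_cong_left) (auto split: if_splits)
    also have "\<dots> = (\<Sum>x\<in>cube n. \<Sum>y\<in>cube n. f' x * g y q * (if ORT b n x y = 1 then 0 else 1))"
      unfolding sumA by (intro sum.cong refl) (simp add: Jf)
    finally have eq: "e q = \<dots>" .
    have f': "f' x \<ge> 0" for x using f by (simp add: f'_def)
    show "h q \<ge> 0" "p q \<le> e q / t + h q / d"
      using rectangular_density_bound[of n f' "\<lambda>y. g y q" b B, OF f' g B B0 n0 n(2)]
      unfolding hq[unfolded pq] pq eq t_def d_def by auto
  qed

  have P': "measure_pmf.prob E err \<le> \<theta> / 400"
  proof -
    have "err = {\<omega>. (\<lambda>(x, y). Some (ORT b n x y)) (fst \<omega>) \<noteq> None \<and>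
        Some (out (tree P) (transcript P \<omega>)) \<noteq> (\<lambda>(x, y). Some (ORT b n x y)) (fst \<omega>)}"
      by (auto simp: err_def case_prod_beta)
    then show ?thesis using P by (simp add: computes_def E_def)
  qed
  have "1 / 84 \<le> measure_pmf.prob (map_pmf fst E) {(x, y). ORT b n x y = 1}"
    unfolding mapX by (rule prob_ORT_eq_1_ge[OF b n(1)])
  also have "\<dots> = measure_pmf.prob E (fst -` {(x, y). ORT b n x y = 1})"
    by simp
  also have "\<dots> \<le> measure_pmf.prob E (Y -` O1 \<union> err)"
    by (intro measure_pmf.finite_measure_mono) (auto simp: O1_def Y_def err_def)
  also have "\<dots> \<le> measure_pmf.prob E (Y -` O1) + measure_pmf.prob E err"
    by (intro measure_Un_le) auto
  finally have O1_ge: "1 / 84 - \<theta> / 400 \<le> measure_pmf.prob E (Y -` O1)"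
    using P' by linarith

  have int_e: "integrable (count_space O1) e" and e_eq: "(\<integral>q. e q \<partial>count_space O1) = measure_pmf.prob J (Bad \<times> O1)"
    using integral_count_space_Times[OF integrable_pmf finBad, of O1 J]
    by (simp_all add: e_def[abs_def] integral_pmf)
  have "measure_pmf.prob J (Bad \<times> O1) = measure_pmf.prob E ((\<lambda>\<omega>. (fst \<omega>, Y \<omega>)) -` (Bad \<times> O1))"
    by (simp add: J_def)
  also have "\<dots> \<le> measure_pmf.prob E err"
    by (intro measure_pmf.finite_measure_mono) (auto simp: O1_def Y_def err_def Bad_def)
  finally have e_le: "(\<integral>q. e q \<partial>count_space O1) \<le> \<theta> / 400"
    using P' e_eq by linarith

  have restr: "count_space O1 = restrict_space (count_space UNIV) O1"
    by (simp add: restrict_count_space)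
  have int_hO: "integrable (count_space O1) h"
    unfolding restr using int_h
    by (subst integrable_restrict_space) (simp, rule integrable_mult_indicator, simp)
  \<comment> \<open>Since every contribution \<open>h q\<close> is nonnegative, restricting to
    output 1 can only decrease the information.\<close>
  have "(\<integral>q. h q \<partial>count_space O1) = (\<integral>q. indicator O1 q *\<^sub>R h q \<partial>count_space UNIV)"
    unfolding restr by (rule integral_restrict_space) simp
  also have "\<dots> \<le> (\<integral>q. h q \<partial>count_space UNIV)"
    using int_h key(1) by (intro integral_mono integrable_mult_indicator) (auto simp: indicator_def)
  finally have h_le: "(\<integral>q. h q \<partial>count_space O1) \<le> ln 2 * icost (unif n) P"
    unfolding mi .

  have "measure_pmf.prob E (Y -` O1) = measure_pmf.prob (map_pmf Y E) O1"
    by simp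
  also have "\<dots> = (\<integral>q. p q \<partial>count_space O1)"
    unfolding p_def by (rule integral_pmf[symmetric])
  also have "\<dots> \<le> (\<integral>q. e q / t + h q / d \<partial>count_space O1)"
    using int_e int_hO unfolding p_def
    by (intro integral_mono integrable_pmf Bochner_Integration.integrable_add integrable_divide key(2)[unfolded p_def])
  also have "\<dots> = (\<integral>q. e q \<partial>count_space O1) / t + (\<integral>q. h q \<partial>count_space O1) / d"
    using int_e int_hO by simp
  also have "\<dots> \<le> \<theta> / 400 / t + ln 2 * icost (unif n) P / d"
    using t d e_le h_le by (intro add_mono divide_right_mono) auto
  also have "\<theta> / 400 / t \<le> 1 / 400"
    using \<theta>t t by (simp add: field_simps)
  finally have O1_le: "measure_pmf.prob E (Y -` O1) \<le> 1 / 400 + ln 2 * icost (unif n) P / d"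
    by simp
  \<comment> \<open>The constants fit because 1/84 - 1/400 - 1/400 \<ge> 1/200.\<close>
  have "\<theta> \<le> 1" using \<theta> tau_le[OF B0] by linarith
  with O1_ge O1_le have "1 / 200 \<le> ln 2 * icost (unif n) P / d" by linarith
  then have I: "d / 200 \<le> ln 2 * icost (unif n) P"
    using d by (simp add: pos_le_divide_eq)
  moreover have "ln 2 \<le> (1 :: real)"
    using ln_le_minus_one[of "2 :: real"] by simp
  moreover have "icost (unif n) P \<ge> 0"
  proof -
    have "0 \<le> ln 2 * icost (unif n) P" using I d by linarith
    then show ?thesis by (simp add: zero_le_mult_iff)
  qed
  ultimately have "d / 200 \<le> icost (unif n) P"
    using mult_right_mono[of "ln 2" 1 "icost (unif n) P"] by linarith
  then show ?thesis by (simp add: d_def)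
qed

theorem theorem4p2:
  fixes b \<theta> :: real
  assumes "b \<ge> 1 / 5"
    and "\<theta> = tail (2.01 * max 66 b)"
  shows "(\<lambda>n. corruption_bound 1 (unif n) \<theta> (\<lambda>(x, y). Some (ORT b n x y))) \<in> \<Omega>(\<lambda>n. real n) \<and>
    (\<lambda>n. IC (unif n) (\<theta> / 400) (\<lambda>(x, y). Some (ORT b n x y))) \<in> \<Omega>(\<lambda>n. real n)"
proof -
  \<comment> \<open>\<open>B\<close> is at least b, so an inner product beyond
    \<open>B * sqrt n\<close> forces the value -1, and at least 66, as the comparison of the tail
    with \<open>tau B\<close> requires.\<close>
  define B where "B = max 66 b"
  have B: "b \<le> B" "B \<ge> 66" by (auto simp: B_def)
  have \<theta>: "0 \<le> \<theta>" "\<theta> < 5 / 16 * tau B"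
    using tail_nonneg[of "2.01 * B"] tail_less_tau[OF B(2)] assms(2) by (auto simp: B_def)
  define N where "N = max 100 (nat \<lceil>(10 / 3 * (B + 5 / 2)) ^ 4\<rceil>)"
  have N: "n \<ge> 100" "(10 / 3 * (B + 5 / 2)) ^ 4 \<le> n" if "n \<ge> N" for n
    using that by (auto simp: N_def ceiling_le_iff nat_le_iff)
  have cb: "delta B * n \<le> corruption_bound 1 (unif n) \<theta> (\<lambda>(x, y). Some (ORT b n x y))" if "n \<ge> N" for n
    using corruption_bound_ORT_ge[OF assms(1) \<theta> B(1) N[OF that]] .
  have ic: "delta B / 200 * n \<le> IC (unif n) (\<theta> / 400) (\<lambda>(x, y). Some (ORT b n x y))" if "n \<ge> N" for n
    unfolding IC_def
  proof (rule cINF_greatest)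
    have "set_pmf (unif n) \<subseteq> cube n \<times> cube n"
      unfolding unif_def using cube_nonempty[of n] by (subst set_pmf_of_set) auto
    then show "{P. computes (unif n) P (\<lambda>(x, y). Some (ORT b n x y)) (\<theta> / 400)} \<noteq> {}"
      using exists_computing_protocol[of "cube n" "cube n" "unif n" "\<theta> / 400" "ORT b n"] \<theta> by auto
    show "delta B / 200 * n \<le> icost (unif n) P"
      if "P \<in> {P. computes (unif n) P (\<lambda>(x, y). Some (ORT b n x y)) (\<theta> / 400)}" for P
      using that icost_ORT_ge[OF _ assms(1) \<theta>(2) B(1) N[OF \<open>n \<ge> N\<close>]] by blast
  qed
  have omega: "u \<in> \<Omega>(\<lambda>n. real n)" if "\<And>n. n \<ge> N \<Longrightarrow> c * real n \<le> u n" "c > 0" for u :: "nat \<Rightarrow> real" and c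
  proof (rule landau_omega.bigI[OF \<open>c > 0\<close>])
    show "\<forall>\<^sub>F n in at_top. c * norm (real n) \<le> norm (u n)"
      using eventually_ge_at_top[of N]
    proof eventually_elim
      case (elim n)
      then show ?case using that(1)[of n] by simp
    qed
  qed
  show ?thesis
    using omega[OF cb delta_pos] omega[OF ic] delta_pos[of B] by simp
qed

end
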